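(* Let $w$ be the solution of the initial-boundary value problem $$\frac{\partial^\alpha w}{\partial t^\alpha}(x,t)=k_\alpha\frac{\partial^2w}{\partial x^2}(x,t)-\frac{\partial}{\partial x}\big(f(x)w(x,t)\big),\quad a\le x\le b,\ 0<t\le T,$$ $$w(x,0)=\varphi(x)\ (a\le x\le b),\qquad w(a,t)=g_1(t),\ w(b,t)=g_2(t)\ (0<t\le T),$$ and assume that $w$ is sufficiently smooth on $[a,b]\times[0,T]$ (i.e. of class $C^m$ for a suitable fixed integer $m$). For each grid let $W_i^n$ be the solution of the finite volume scheme described in the context, with boundary values $W^n_0=g_1(t_n)$, $W^n_{N+1}=g_2(t_n)$ and initial values $W_i^0$ taken as approximations to $\varphi(x_i)$. Put $e_i^n=w(x_i,t_n)-W_i^n$ and $e^n=(e_1^n,\ldots,e_N^n)^T$, $n=0,1,\ldots,L$. Then there is a constant $C>0$, independent of the grid sizes (of $N$, $L$, and of $n$ and $W^0$), such that for all $n=1,2,\ldots,L$: (i) $\|e^n\|_1\le\|e^0\|_1+C(\Delta t^{2-\alpha}+h)$; (ii) if the space grid is sufficiently fine that $h\cdot\max_{x\in[a,b]}|f(x)|\le 2k_\alpha$, then $\|e^n\|_1\le\|e^0\|_1+C(\Delta t^{2-\alpha}+h^2)$.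
   Context: Let $a<b$, $T>0$, $\alpha\in(0,1)$, $k_\alpha>0$ be real constants, and let $f:[a,b]\to\mathbb{R}$ be Lipschitz: $|f(x)-f(x')|\le C|x-x'|$ for all $x,x'\in[a,b]$. The Caputo derivative is $$\frac{\partial^\alpha w(x,t)}{\partial t^\alpha}=\frac1{\Gamma(1-\alpha)}\int_0^t\frac{\partial w(x,\eta)}{\partial\eta}\frac{d\eta}{(t-\eta)^\alpha}.$$ For positive integers $N,L$ put $h=(b-a)/(N+1)$, $x_i=a+ih$ ($i=0,\ldots,N+1$), $x_{i+\frac12}=a+(i+\frac12)h$ ($i=0,\ldots,N$), $\Delta t=T/L$, $t_k=k\Delta t$ ($k=0,\ldots,L$). $\Gamma$ is the gamma function and $a_k=(k+1)^{1-\alpha}-k^{1-\alpha}$ for $k=0,1,2,\ldots$. Decompose $f=f^u+f^l+f^m$ with $f^u(x)=\max(f(x)-\frac{2k_\alpha}{h},0)$, $f^l(x)=\min(f(x)+\frac{2k_\alpha}{h},0)$, $f^m=f-f^u-f^l$. A subscript $i+\frac12$ denotes evaluation at $x_{i+\frac12}$. Finite volume scheme: for grid values $W_i^n$ ($0\le i\le N+1$, $1\le n\le L$) set, for $i=0,\ldots,N$, $$\widehat{\left(\tfrac{\partial W}{\partial x}\right)}_{i+\frac12,n}=\frac{W_{i+1}^n-W_i^n}{h},\qquad \widetilde{(fW)}_{i+\frac12,n}=f^m_{i+\frac12}\frac{W_i^n+W_{i+1}^n}{2}+f^u_{i+\frac12}W_i^n+f^l_{i+\frac12}W_{i+1}^n.$$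 The scheme requires, for $i=1,\ldots,N$ and $n=1,\ldots,L$, $$\frac{h\Delta t^{-\alpha}}{\Gamma(2-\alpha)}\left(W_i^n-\sum_{k=1}^{n-1}(a_{n-k-1}-a_{n-k})W_i^k-a_{n-1}W_i^0\right)=k_\alpha\left(\widehat{\left(\tfrac{\partial W}{\partial x}\right)}_{i+\frac12,n}-\widehat{\left(\tfrac{\partial W}{\partial x}\right)}_{i-\frac12,n}\right)-\left(\widetilde{(fW)}_{i+\frac12,n}-\widetilde{(fW)}_{i-\frac12,n}\right),$$ with $W_0^n=g_1(t_n)$, $W_{N+1}^n=g_2(t_n)$ for $n=1,\ldots,L$ and given initial values $W_i^0$, $i=1,\ldots,N$. The discrete $L^1$ norm on $\mathbb{R}^N$ is $\|W\|_1=\sum_{i=1}^N h|W_i|$. *)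

theory Defs
  imports "HOL-Analysis.Analysis"
begin

section \<open>Functions of class $C^m$\<close>

text \<open>
  Derivatives are taken relative to \<open>S\<close>, so for a closed rectangle they are one-sided on the
  boundary; \<open>C_on m S u\<close> then says that all partial derivatives of \<open>u\<close> of order at most \<open>m\<close>
  exist and are continuous up to the boundary. The intended \<open>S\<close> are sets on which the relative
  derivative is unique, such as convex sets with nonempty interior.
\<close>

primrec C_on ::
  "nat \<Rightarrow> 'a::euclidean_space set \<Rightarrow> ('a \<Rightarrow> real) \<Rightarrow> bool" where
  "C_on 0 S u \<longleftrightarrow> continuous_on S u"
| "C_on (Suc m) S u \<longleftrightarrow>
     (\<exists>D. (\<forall>z\<in>S. (u has_derivative D z) (at z within S)) \<and> (\<forall>v. C_on m S (\<lambda>z. D z v)))"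

section \<open>The time-fractional initial-boundary value problem\<close>

text \<open>
  Here \<open>u\<close> is a function of time only. The integrand at the end points \<open>0\<close> and \<open>t\<close>, where
  \<open>deriv u\<close> or the kernel need not be meaningful, does not affect the value.
\<close>

definition caputo :: "real \<Rightarrow> (real \<Rightarrow> real) \<Rightarrow> real \<Rightarrow> real" where
  "caputo \<alpha> u t = 1 / Gamma (1 - \<alpha>) * integral {0..t} (\<lambda>\<eta>. deriv u \<eta> / (t - \<eta>) powr \<alpha>)"

text \<open>
  Since \<open>f\<close> need not be differentiable, the existence of the derivative \<open>q\<close> of the product
  \<open>f w\<close> is part of being a solution. Space derivatives at \<open>a\<close> and \<open>b\<close> are one-sided.
\<close>

definition ibvp_solution ::
  "real \<Rightarrow> real \<Rightarrow> real \<Rightarrow> real \<Rightarrow> real \<Rightarrow> (real \<Rightarrow> real) \<Rightarrow> (real \<Rightarrow> real) \<Rightarrow> (real \<Rightarrow> real) \<Rightarrow>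
    (real \<Rightarrow> real) \<Rightarrow> (real \<Rightarrow> real \<Rightarrow> real) \<Rightarrow> bool" where
  "ibvp_solution a b T \<alpha> \<kappa> f \<phi> g1 g2 w \<longleftrightarrow>
     (\<exists>wx wxx q. \<forall>x\<in>{a..b}. \<forall>t\<in>{0<..T}.
        ((\<lambda>y. w y t) has_real_derivative wx x t) (at x within {a..b}) \<and>
        ((\<lambda>y. wx y t) has_real_derivative wxx x t) (at x within {a..b}) \<and>
        ((\<lambda>y. f y * w y t) has_real_derivative q x t) (at x within {a..b}) \<and>
        caputo \<alpha> (w x) t = \<kappa> * wxx x t - q x t) \<and>
     (\<forall>x\<in>{a..b}. w x 0 = \<phi> x) \<and>
     (\<forall>t\<in>{0<..T}. w a t = g1 t \<and> w b t = g2 t)"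

section \<open>The finite volume scheme\<close>

definition space_step :: "real \<Rightarrow> real \<Rightarrow> nat \<Rightarrow> real" where
  "space_step a b N = (b - a) / (real N + 1)"

definition time_step :: "real \<Rightarrow> nat \<Rightarrow> real" where
  "time_step T L = T / real L"

definition node :: "real \<Rightarrow> real \<Rightarrow> nat \<Rightarrow> real" where
  "node a h i = a + real i * h"

text \<open>\<open>midpoint_node a h i\<close> is $x_{i+1/2}$; thus $x_{i-1/2}$ is \<open>midpoint_node a h (i - 1)\<close>.\<close>

definition midpoint_node :: "real \<Rightarrow> real \<Rightarrow> nat \<Rightarrow> real" where
  "midpoint_node a h i = a + (real i + 1 / 2) * h"

definition time_node :: "real \<Rightarrow> nat \<Rightarrow> real" where
  "time_node \<tau> n = real n * \<tau>"

definition L1_coeff :: "real \<Rightarrow> nat \<Rightarrow> real" where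
  "L1_coeff \<alpha> k = (real k + 1) powr (1 - \<alpha>) - real k powr (1 - \<alpha>)"

definition f_upper :: "real \<Rightarrow> real \<Rightarrow> (real \<Rightarrow> real) \<Rightarrow> real \<Rightarrow> real" where
  "f_upper \<kappa> h f x = max (f x - 2 * \<kappa> / h) 0"

definition f_lower :: "real \<Rightarrow> real \<Rightarrow> (real \<Rightarrow> real) \<Rightarrow> real \<Rightarrow> real" where
  "f_lower \<kappa> h f x = min (f x + 2 * \<kappa> / h) 0"

definition f_middle :: "real \<Rightarrow> real \<Rightarrow> (real \<Rightarrow> real) \<Rightarrow> real \<Rightarrow> real" where
  "f_middle \<kappa> h f x = f x - f_upper \<kappa> h f x - f_lower \<kappa> h f x"

text \<open>
  Grid values are written \<open>W i n\<close>, with the space index first. The two numerical fluxes below are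
  those at $x_{i+1/2}$.
\<close>

definition diffusive_flux :: "real \<Rightarrow> (nat \<Rightarrow> nat \<Rightarrow> real) \<Rightarrow> nat \<Rightarrow> nat \<Rightarrow> real" where
  "diffusive_flux h W i n = (W (i + 1) n - W i n) / h"

definition advective_flux ::
  "real \<Rightarrow> real \<Rightarrow> real \<Rightarrow> (real \<Rightarrow> real) \<Rightarrow> (nat \<Rightarrow> nat \<Rightarrow> real) \<Rightarrow> nat \<Rightarrow> nat \<Rightarrow> real" where
  "advective_flux a \<kappa> h f W i n =
     f_middle \<kappa> h f (midpoint_node a h i) * ((W i n + W (i + 1) n) / 2)
     + f_upper \<kappa> h f (midpoint_node a h i) * W i n
     + f_lower \<kappa> h f (midpoint_node a h i) * W (i + 1) n"

definition fv_solution ::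
  "real \<Rightarrow> real \<Rightarrow> real \<Rightarrow> real \<Rightarrow> real \<Rightarrow> (real \<Rightarrow> real) \<Rightarrow> (real \<Rightarrow> real) \<Rightarrow> (real \<Rightarrow> real) \<Rightarrow>
    nat \<Rightarrow> nat \<Rightarrow> (nat \<Rightarrow> nat \<Rightarrow> real) \<Rightarrow> bool" where
  "fv_solution a b T \<alpha> \<kappa> f g1 g2 N L W \<longleftrightarrow>
     (let h = space_step a b N; \<tau> = time_step T L in
      (\<forall>i\<in>{1..N}. \<forall>n\<in>{1..L}.
         h * \<tau> powr (- \<alpha>) / Gamma (2 - \<alpha>) *
           (W i n
            - (\<Sum>k = 1..<n. (L1_coeff \<alpha> (n - k - 1) - L1_coeff \<alpha> (n - k)) * W i k)
            - L1_coeff \<alpha> (n - 1) * W i 0)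
         = \<kappa> * (diffusive_flux h W i n - diffusive_flux h W (i - 1) n)
           - (advective_flux a \<kappa> h f W i n - advective_flux a \<kappa> h f W (i - 1) n)) \<and>
      (\<forall>n\<in>{1..L}. W 0 n = g1 (time_node \<tau> n) \<and> W (N + 1) n = g2 (time_node \<tau> n)))"

text \<open>The vector of $\mathbf{R}^N$ is given by the values of \<open>v\<close> at \<open>1, \<dots>, N\<close>.\<close>

definition discrete_L1_norm :: "real \<Rightarrow> nat \<Rightarrow> (nat \<Rightarrow> real) \<Rightarrow> real" where
  "discrete_L1_norm h N v = (\<Sum>i = 1..N. h * \<bar>v i\<bar>)"

definition grid_error ::
  "real \<Rightarrow> real \<Rightarrow> real \<Rightarrow> (real \<Rightarrow> real \<Rightarrow> real) \<Rightarrow> (nat \<Rightarrow> nat \<Rightarrow> real) \<Rightarrow> nat \<Rightarrow> nat \<Rightarrow> real" where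
  "grid_error a h \<tau> w W n i = w (node a h i) (time_node \<tau> n) - W i n"

end

theory Submission
  imports Defs
begin

text \<open>
  Both estimates follow from a bound \<open>h * O(\<tau> powr (2 - \<alpha>) + h\<^sup>2)\<close> for the residual of the exact
  solution in the scheme, valid on every grid, together with stability in the discrete \<open>L\<^sup>1\<close> norm.

  For the stability, the total numerical flux has the form \<open>p i * W (i + 1) - q i * W i\<close> with
  nonnegative \<open>p\<close> and \<open>q\<close>, which is the purpose of the splitting of \<open>f\<close>. Multiplying the error equation by
  the sign of the error and summing over the cells, the flux terms telescope to something nonpositive,
  and a discrete fractional Gronwall inequality remains.

  For the residual, the \<open>L1\<close> formula is of order \<open>2 - \<alpha>\<close> in time. In space, \<open>\<kappa> * w\<^sub>x - f * w\<close> has the Caputo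
  derivative of \<open>w\<close> as its derivative, so its difference over a cell is that derivative at the cell
  centre up to second differences, which are those of \<open>w\<^sub>t\<close> under the integral sign; this needs
  no smoothness of \<open>f\<close>. The errors of the two numerical fluxes are of order \<open>h\<^sup>2\<close> with a
  Lipschitz dependence on the position, so that their differences over a cell are of order \<open>h\<^sup>3\<close>.
\<close>

section \<open>Stability\<close>

lemma L1_coeff_0 [simp]: "L1_coeff \<alpha> 0 = 1"
  by (simp add: L1_coeff_def)

text \<open>By the mean value theorem for \<open>x powr (1 - \<alpha>)\<close> on
  \<open>[k, k + 1]\<close> the weight equals \<open>(1 - \<alpha>) * z powr (- \<alpha>)\<close>
  with \<open>z\<close> strictly inside, and this power is decreasing in \<open>z\<close>. At
  \<open>k = 0\<close> the upper bound would fail, because \<open>0 powr (- \<alpha>)\<close> is 0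
  in HOL while the weight is 1.\<close>

lemma L1_coeff_bounds:
  assumes "0 < \<alpha>" "\<alpha> < 1"
  shows "(1 - \<alpha>) * (real k + 1) powr (- \<alpha>) \<le> L1_coeff \<alpha> k"
    and "0 < k \<Longrightarrow> L1_coeff \<alpha> k \<le> (1 - \<alpha>) * real k powr (- \<alpha>)"
proof -
  let ?p = "\<lambda>x::real. x powr (1 - \<alpha>)"
  have "\<exists>l z. real k < z \<and> z < real k + 1 \<and> (?p has_real_derivative l) (at z) \<and>
      ?p (real k + 1) - ?p (real k) = (real k + 1 - real k) * l"
  proof (rule MVT)
    show "continuous_on {real k..real k + 1} ?p"
      using assms by (intro continuous_on_powr' continuous_intros) auto
    fix x assume "real k < x"
    then have "(?p has_real_derivative (1 - \<alpha>) * x powr (1 - \<alpha> - 1)) (at x)"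
      by (intro has_real_derivative_powr) linarith
    then show "?p differentiable (at x)"
      unfolding real_differentiable_def by blast
  qed simp
  then obtain l z where z: "real k < z" "z < real k + 1" "(?p has_real_derivative l) (at z)"
    "?p (real k + 1) - ?p (real k) = l" by auto
  have "(?p has_real_derivative (1 - \<alpha>) * z powr (1 - \<alpha> - 1)) (at z)"
    using z by (intro has_real_derivative_powr) linarith
  from DERIV_unique[OF z(3) this] have l: "L1_coeff \<alpha> k = (1 - \<alpha>) * z powr (- \<alpha>)"
    using z by (simp add: L1_coeff_def)
  show "(1 - \<alpha>) * (real k + 1) powr (- \<alpha>) \<le> L1_coeff \<alpha> k"
    unfolding l using assms z by (intro mult_left_mono powr_mono2') auto
  show "L1_coeff \<alpha> k \<le> (1 - \<alpha>) * real k powr (- \<alpha>)" if "0 < k"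
    unfolding l using assms z that by (intro mult_left_mono powr_mono2') auto
qed

lemma L1_coeff_pos:
  assumes "0 < \<alpha>" "\<alpha> < 1"
  shows "0 < L1_coeff \<alpha> k"
proof -
  have "0 < (1 - \<alpha>) * (real k + 1) powr (- \<alpha>)"
    using assms by auto
  with L1_coeff_bounds(1)[OF assms, of k] show ?thesis by linarith
qed

text \<open>The number \<open>(1 - \<alpha>) * (real k + 1) powr (- \<alpha>)\<close> is a lower
  bound for the weight of index \<open>k\<close> and an upper bound for that of index
  \<open>k + 1\<close>, so it separates consecutive weights.\<close>

lemma L1_coeff_antimono:
  assumes "0 < \<alpha>" "\<alpha> < 1" "j \<le> k"
  shows "L1_coeff \<alpha> k \<le> L1_coeff \<alpha> j"
proof -
  have "antimono (L1_coeff \<alpha>)"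
    unfolding antimono_iff_le_Suc
    using L1_coeff_bounds(1)[OF assms(1,2)] L1_coeff_bounds(2)[OF assms(1,2)]
    by (metis Suc_eq_plus1 add.commute of_nat_Suc order_trans zero_less_Suc)
  then show ?thesis using assms(3) by (rule antimonoD)
qed

text \<open>Together with the weight \<open>L1_coeff \<alpha> (n - 1)\<close> of the initial value,
  the weights of the past values add up to 1. As they are nonnegative, the history term of the
  scheme is a convex combination.\<close>

lemma sum_L1_coeff_diff:
  assumes "1 \<le> n"
  shows "(\<Sum>k = 1..<n. L1_coeff \<alpha> (n - k - 1) - L1_coeff \<alpha> (n - k)) = 1 - L1_coeff \<alpha> (n - 1)"
proof -
  obtain m where n: "n = Suc m" using assms by (cases n) auto
  have "(\<Sum>k = 1..<n. L1_coeff \<alpha> (n - k - 1) - L1_coeff \<alpha> (n - k)) =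
    (\<Sum>k = 1..<Suc m. - (L1_coeff \<alpha> (Suc m - k) - L1_coeff \<alpha> (Suc m - Suc k)))"
    by (intro sum.cong) (auto simp: n)
  also have "\<dots> = 1 - L1_coeff \<alpha> m"
    using sum_Suc_diff'[of 1 "Suc m" "\<lambda>k. L1_coeff \<alpha> (Suc m - k)"] by (simp add: sum_subtractf)
  finally show ?thesis by (simp add: n)
qed

text \<open>Integrating the kernel against a piecewise constant derivative produces increments of
  \<open>u\<close>, whereas the scheme is written in values of \<open>u\<close>. Abel summation
  connects the two forms; the weight of \<open>u n\<close> is
  \<open>L1_coeff \<alpha> 0 = 1\<close>.\<close>

lemma L1_coeff_summation_by_parts:
  fixes u :: "nat \<Rightarrow> real"
  assumes "1 \<le> n"
  shows "(\<Sum>k<n. L1_coeff \<alpha> (n - k - 1) * (u (k + 1) - u k)) =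
    u n - (\<Sum>k = 1..<n. (L1_coeff \<alpha> (n - k - 1) - L1_coeff \<alpha> (n - k)) * u k) - L1_coeff \<alpha> (n - 1) * u 0"
proof -
  obtain m where n: "n = Suc m" using assms by (cases n) auto
  have "(\<Sum>k<n. L1_coeff \<alpha> (n - k - 1) * u (k + 1)) = (\<Sum>k<m. L1_coeff \<alpha> (m - k) * u (k + 1)) + u n"
    by (simp add: n)
  also have "(\<Sum>k<m. L1_coeff \<alpha> (m - k) * u (k + 1)) = (\<Sum>k=1..<n. L1_coeff \<alpha> (n - k) * u k)"
    using sum.shift_bounds_Suc_ivl[of "\<lambda>k. L1_coeff \<alpha> (n - k) * u k" 0 m]
    by (simp add: n atLeast0LessThan)
  finally have 1: "(\<Sum>k<n. L1_coeff \<alpha> (n - k - 1) * u (k + 1)) = (\<Sum>k=1..<n. L1_coeff \<alpha> (n - k) * u k) + u n" .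
  have 2: "(\<Sum>k<n. L1_coeff \<alpha> (n - k - 1) * u k) = L1_coeff \<alpha> (n - 1) * u 0 + (\<Sum>k=1..<n. L1_coeff \<alpha> (n - k - 1) * u k)"
    using assms by (subst lessThan_atLeast0, subst sum.atLeast_Suc_lessThan) auto
  show ?thesis
    unfolding right_diff_distrib left_diff_distrib sum_subtractf 1 2 by simp
qed

text \<open>The weights decrease, so the bounds at all earlier levels are at most the bound
  \<open>?B\<close> at level \<open>n\<close>. Inserting \<open>?B\<close> for every past value with
  \<open>k \<ge> 1\<close> leaves \<open>(1 - c) * ?B + c * E 0 + \<rho>\<close> with
  \<open>c = L1_coeff \<alpha> (n - 1)\<close>, and this is exactly \<open>?B\<close>.\<close>

lemma fractional_gronwall:
  fixes E :: "nat \<Rightarrow> real"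
  assumes \<alpha>: "0 < \<alpha>" "\<alpha> < 1" and "0 \<le> \<rho>"
    and step: "\<And>n. n \<in> {1..L} \<Longrightarrow>
      E n \<le> (\<Sum>k = 1..<n. (L1_coeff \<alpha> (n - k - 1) - L1_coeff \<alpha> (n - k)) * E k)
        + L1_coeff \<alpha> (n - 1) * E 0 + \<rho>"
  assumes "n \<in> {1..L}"
  shows "E n \<le> E 0 + \<rho> / L1_coeff \<alpha> (n - 1)"
  using \<open>n \<in> {1..L}\<close>
proof (induction n rule: less_induct)
  case (less n)
  let ?a = "L1_coeff \<alpha>" and ?B = "E 0 + \<rho> / L1_coeff \<alpha> (n - 1)"
  have "(?a (n - k - 1) - ?a (n - k)) * E k \<le> (?a (n - k - 1) - ?a (n - k)) * ?B"
    if "k \<in> {1..<n}" for k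
  proof (rule mult_left_mono)
    have "\<rho> / ?a (k - 1) \<le> \<rho> / ?a (n - 1)"
      using that \<open>0 \<le> \<rho>\<close> L1_coeff_pos[OF \<alpha>]
      by (intro divide_left_mono L1_coeff_antimono[OF \<alpha>] mult_pos_pos) auto
    then show "E k \<le> ?B"
      using less.IH[of k] less.prems that by auto
    show "0 \<le> ?a (n - k - 1) - ?a (n - k)"
      using L1_coeff_antimono[OF \<alpha>, of "n - k - 1" "n - k"] by simp
  qed
  then have "(\<Sum>k = 1..<n. (?a (n - k - 1) - ?a (n - k)) * E k)
      \<le> (\<Sum>k = 1..<n. (?a (n - k - 1) - ?a (n - k)) * ?B)"
    by (rule sum_mono)
  also have "\<dots> = (1 - ?a (n - 1)) * ?B"
    using less.prems by (subst sum_distrib_right[symmetric], subst sum_L1_coeff_diff) auto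
  finally have "E n \<le> (1 - ?a (n - 1)) * ?B + ?a (n - 1) * E 0 + \<rho>"
    using step[OF less.prems] by linarith
  also have "\<dots> = ?B"
    using L1_coeff_pos[OF \<alpha>, of "n - 1"] by (simp add: field_simps)
  finally show ?case .
qed

section \<open>Sign structure of the numerical flux and stability of the scheme\<close>

lemma sum_sgn_flux_difference_nonpos:
  fixes v p q :: "nat \<Rightarrow> real"
  assumes "\<And>i. 0 \<le> p i" "\<And>i. 0 \<le> q i" "v 0 = 0" "v (N + 1) = 0"
    and F: "\<And>i. F i = p i * v (i + 1) - q i * v i"
  shows "(\<Sum>i = 1..N. sgn (v i) * (F i - F (i - 1))) \<le> 0"
proof -
  \<comment> \<open>\<open>\<Phi>\<close> is the flux of the moduli. In
    \<open>F i - F (i - 1)\<close> the neighbours of \<open>v i\<close> have nonnegative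
    coefficients and \<open>v i\<close> itself has a nonpositive one, so multiplication by the sign
    of \<open>v i\<close> gives at most \<open>\<Phi> i - \<Phi> (i - 1)\<close>. After telescoping,
    the zero boundary values leave only
    \<open>- q N * \<bar>v N\<bar> - p 0 * \<bar>v 1\<bar>\<close>.\<close>
  define \<Phi> where "\<Phi> i = p i * \<bar>v (i + 1)\<bar> - q i * \<bar>v i\<bar>" for i
  have "sgn (v i) * (F i - F (i - 1)) \<le> \<Phi> i - \<Phi> (i - 1)" if "i \<in> {1..N}" for i
  proof -
    have sgn_le: "sgn (v i) * (c * x) \<le> c * \<bar>x\<bar>" if "0 \<le> c" for c x
    proof -
      have "sgn (v i) * x \<le> \<bar>x\<bar>" by (auto simp: sgn_if)
      from mult_left_mono[OF this that] show ?thesis by (simp add: mult_ac)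
    qed
    have sgn_eq: "sgn (v i) * (c * v i) = c * \<bar>v i\<bar>" for c
      by (metis abs_sgn mult.commute mult.left_commute)
    have "i - 1 + 1 = i" using that by auto
    then have "sgn (v i) * (F i - F (i - 1)) = sgn (v i) * (p i * v (i + 1)) + sgn (v i) * (q (i - 1) * v (i - 1))
        - sgn (v i) * (q i * v i) - sgn (v i) * (p (i - 1) * v i)"
      unfolding F by (simp add: algebra_simps)
    also have "\<dots> \<le> \<Phi> i - \<Phi> (i - 1)"
      unfolding \<Phi>_def sgn_eq using \<open>i - 1 + 1 = i\<close> sgn_le[OF assms(1)[of i], of "v (i+1)"] sgn_le[OF assms(2)[of "i - 1"], of "v (i - 1)"]
      by simp
    finally show ?thesis .
  qed
  then have "(\<Sum>i = 1..N. sgn (v i) * (F i - F (i - 1))) \<le> (\<Sum>i = 1..N. \<Phi> i - \<Phi> (i - 1))"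
    by (rule sum_mono)
  also have "\<dots> = \<Phi> N - \<Phi> 0"
    by (induction N) auto
  also have "\<dots> \<le> 0"
    using assms(3,4) mult_nonneg_nonneg[OF assms(2)[of N] abs_ge_zero[of "v N"]]
      mult_nonneg_nonneg[OF assms(1)[of 0] abs_ge_zero[of "v 1"]] by (simp add: \<Phi>_def)
  finally show ?thesis .
qed

text \<open>\<open>f_middle\<close> is \<open>f\<close> cut off at the levels
  \<open>- 2 * \<kappa> / h\<close> and \<open>2 * \<kappa> / h\<close>, so half of it is dominated
  by the diffusion coefficient \<open>\<kappa> / h\<close>. What is cut off enters \<open>p\<close>
  as \<open>- f_lower\<close> and \<open>q\<close> as \<open>f_upper\<close>, both
  nonnegative.\<close>

lemma scheme_flux_eq:
  fixes v :: "nat \<Rightarrow> nat \<Rightarrow> real"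
  assumes "0 < \<kappa>" "0 < h"
  obtains p q where "\<And>i. 0 \<le> p i" "\<And>i. 0 \<le> q i"
    "\<And>i n. \<kappa> * diffusive_flux h v i n - advective_flux a \<kappa> h f v i n = p i * v (i + 1) n - q i * v i n"
proof -
  let ?f = "\<lambda>i. f (midpoint_node a h i)"
  have pos: "0 < \<kappa> / h" using assms by simp
  have le1: "0 \<le> c - (g - max (g - (c + c)) 0 - min (g + (c + c)) 0) / 2 - min (g + (c + c)) 0"
    and le2: "0 \<le> c + (g - max (g - (c + c)) 0 - min (g + (c + c)) 0) / 2 + max (g - (c + c)) 0"
    if "0 < c" for c g :: real
    using that by (cases "g \<le> c + c"; cases "- (c + c) \<le> g"; simp)+
  define p where "p i = \<kappa> / h - f_middle \<kappa> h f (midpoint_node a h i) / 2 - f_lower \<kappa> h f (midpoint_node a h i)" for i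
  define q where "q i = \<kappa> / h + f_middle \<kappa> h f (midpoint_node a h i) / 2 + f_upper \<kappa> h f (midpoint_node a h i)" for i
  show thesis
  proof
    have two: "2 * \<kappa> / h = \<kappa> / h + \<kappa> / h" by simp
    show "0 \<le> p i" for i
      using pos unfolding p_def f_middle_def f_lower_def f_upper_def two by (rule le1)
    show "0 \<le> q i" for i
      using pos unfolding q_def f_middle_def f_lower_def f_upper_def two by (rule le2)
    show "\<kappa> * diffusive_flux h v i n - advective_flux a \<kappa> h f v i n = p i * v (i + 1) n - q i * v i n" for i n
      by (simp add: p_def q_def diffusive_flux_def advective_flux_def algebra_simps diff_divide_distrib add_divide_distrib)
  qed
qed

text \<open>Left side minus right side of the scheme, for an arbitrary grid function. It is linear
  in \<open>W\<close> and vanishes for a solution of the scheme, so the residual of the error is the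
  residual of the exact solution.\<close>

definition scheme_residual ::
  "real \<Rightarrow> real \<Rightarrow> real \<Rightarrow> real \<Rightarrow> real \<Rightarrow> (real \<Rightarrow> real) \<Rightarrow> (nat \<Rightarrow> nat \<Rightarrow> real) \<Rightarrow> nat \<Rightarrow> nat \<Rightarrow> real" where
  "scheme_residual a \<alpha> \<kappa> h \<tau> f W i n =
     h * \<tau> powr (- \<alpha>) / Gamma (2 - \<alpha>) *
       (W i n
        - (\<Sum>k = 1..<n. (L1_coeff \<alpha> (n - k - 1) - L1_coeff \<alpha> (n - k)) * W i k)
        - L1_coeff \<alpha> (n - 1) * W i 0)
     - (\<kappa> * (diffusive_flux h W i n - diffusive_flux h W (i - 1) n)
       - (advective_flux a \<kappa> h f W i n - advective_flux a \<kappa> h f W (i - 1) n))"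

lemma diffusive_flux_diff:
  "diffusive_flux h (\<lambda>i n. V i n - W i n) i n = diffusive_flux h V i n - diffusive_flux h W i n"
  by (simp add: diffusive_flux_def diff_divide_distrib)

lemma advective_flux_diff:
  "advective_flux a \<kappa> h f (\<lambda>i n. V i n - W i n) i n =
    advective_flux a \<kappa> h f V i n - advective_flux a \<kappa> h f W i n"
  by (simp add: advective_flux_def algebra_simps diff_divide_distrib add_divide_distrib)

lemma scheme_residual_diff:
  "scheme_residual a \<alpha> \<kappa> h \<tau> f (\<lambda>i n. V i n - W i n) i n =
    scheme_residual a \<alpha> \<kappa> h \<tau> f V i n - scheme_residual a \<alpha> \<kappa> h \<tau> f W i n"
proof -
  have sum_diff: "(\<Sum>k = 1..<n. (L1_coeff \<alpha> (n - k - 1) - L1_coeff \<alpha> (n - k)) * (V i k - W i k)) =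
      (\<Sum>k = 1..<n. (L1_coeff \<alpha> (n - k - 1) - L1_coeff \<alpha> (n - k)) * V i k)
      - (\<Sum>k = 1..<n. (L1_coeff \<alpha> (n - k - 1) - L1_coeff \<alpha> (n - k)) * W i k)"
    by (simp only: right_diff_distrib sum_subtractf)
  show ?thesis
    unfolding scheme_residual_def diffusive_flux_diff advective_flux_diff sum_diff
    by (simp only: algebra_simps)
qed

text \<open>The discrete norms of \<open>e\<close> satisfy the hypothesis of
  \<open>fractional_gronwall\<close>. The residual contributes at most \<open>h * \<rho>\<close> in
  each of \<open>N\<close> cells, and division by the factor of the time difference turns the sum
  into the stated source term.\<close>

lemma fv_scheme_stability:
  fixes e :: "nat \<Rightarrow> nat \<Rightarrow> real"
  assumes \<alpha>: "0 < \<alpha>" "\<alpha> < 1" and pos: "0 < \<kappa>" "0 < h" "0 < \<tau>" "0 \<le> \<rho>"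
    and bdry: "\<And>n. n \<in> {1..L} \<Longrightarrow> e 0 n = 0" "\<And>n. n \<in> {1..L} \<Longrightarrow> e (N + 1) n = 0"
    and resid: "\<And>i n. i \<in> {1..N} \<Longrightarrow> n \<in> {1..L} \<Longrightarrow>
      \<bar>scheme_residual a \<alpha> \<kappa> h \<tau> f e i n\<bar> \<le> h * \<rho>"
    and n: "n \<in> {1..L}"
  shows "discrete_L1_norm h N (\<lambda>i. e i n) \<le> discrete_L1_norm h N (\<lambda>i. e i 0)
    + Gamma (2 - \<alpha>) * \<tau> powr \<alpha> * (real N * h * \<rho>) / L1_coeff \<alpha> (n - 1)"
proof -
  define c where "c = \<tau> powr (- \<alpha>) / Gamma (2 - \<alpha>)"
  have "0 < Gamma (2 - \<alpha>)"
    using \<alpha> by (intro Gamma_real_pos) auto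
  then have c: "0 < c" and c_inv: "1 / c = Gamma (2 - \<alpha>) * \<tau> powr \<alpha>"
    using pos by (auto simp: c_def powr_minus field_simps)
  obtain p q where pq: "\<And>i. 0 \<le> p i" "\<And>i. 0 \<le> q i"
    "\<And>i n. \<kappa> * diffusive_flux h e i n - advective_flux a \<kappa> h f e i n = p i * e (i + 1) n - q i * e i n"
    using scheme_flux_eq[OF pos(1,2), where a=a and f=f and v=e] by metis
  define E where "E k = discrete_L1_norm h N (\<lambda>i. e i k)" for k
  have "E n \<le> E 0 + 1 / c * (real N * h * \<rho>) / L1_coeff \<alpha> (n - 1)"
  proof (rule fractional_gronwall[OF \<alpha> _ _ n])
    show "0 \<le> 1 / c * (real N * h * \<rho>)"
      using c pos by simp
    fix n assume n: "n \<in> {1..L}"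
    define A where "A k = L1_coeff \<alpha> (n - k - 1) - L1_coeff \<alpha> (n - k)" for k
    define F where "F i = \<kappa> * diffusive_flux h e i n - advective_flux a \<kappa> h f e i n" for i
    have A: "0 \<le> A k" for k
      unfolding A_def using L1_coeff_antimono[OF \<alpha>, of "n - k - 1" "n - k"] by simp
    have "h * \<bar>e i n\<bar> \<le> (\<Sum>k = 1..<n. A k * (h * \<bar>e i k\<bar>)) + L1_coeff \<alpha> (n - 1) * (h * \<bar>e i 0\<bar>)
        + 1 / c * (sgn (e i n) * (F i - F (i - 1)) + h * \<rho>)" if i: "i \<in> {1..N}" for i
    proof -
      let ?s = "sgn (e i n)"
      let ?S = "\<Sum>k = 1..<n. A k * e i k" and ?S' = "\<Sum>k = 1..<n. A k * \<bar>e i k\<bar>"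
      define r where "r = h * c * (e i n - ?S - L1_coeff \<alpha> (n - 1) * e i 0) - (F i - F (i - 1))"
      have "\<bar>r\<bar> \<le> h * \<rho>"
        using resid[OF i n] unfolding scheme_residual_def r_def F_def A_def c_def by (simp add: algebra_simps)
      moreover have sgn_le: "?s * x \<le> \<bar>x\<bar>" for x :: real
        by (auto simp: sgn_if)
      ultimately have "?s * r \<le> h * \<rho>"
        using order_trans by blast
      moreover have "?s * e i n = \<bar>e i n\<bar>"
        by (metis abs_sgn mult.commute)
      moreover have "?s * ?S \<le> ?S'"
        by (rule order_trans[OF order_trans[OF sgn_le sum_abs]]) (simp add: abs_mult A)
      moreover have "?s * (L1_coeff \<alpha> (n - 1) * e i 0) \<le> L1_coeff \<alpha> (n - 1) * \<bar>e i 0\<bar>"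
        using sgn_le[of "L1_coeff \<alpha> (n - 1) * e i 0"] L1_coeff_pos[OF \<alpha>, of "n - 1"]
        by (simp add: abs_mult)
      \<comment> \<open>Testing with the sign keeps the full modulus of the new value, while the
        past values, having nonnegative weights, lose at most their moduli.\<close>
      ultimately have *: "\<bar>e i n\<bar> \<le> ?S' + L1_coeff \<alpha> (n - 1) * \<bar>e i 0\<bar>
          + ?s * (e i n - ?S - L1_coeff \<alpha> (n - 1) * e i 0)"
        by (simp add: algebra_simps)
      have "h * (?s * (e i n - ?S - L1_coeff \<alpha> (n - 1) * e i 0)) = 1 / c * (?s * (r + (F i - F (i - 1))))"
        using c by (simp add: r_def)
      also have "\<dots> \<le> 1 / c * (?s * (F i - F (i - 1)) + h * \<rho>)"
        using c \<open>?s * r \<le> h * \<rho>\<close> by (intro mult_left_mono) (auto simp: algebra_simps)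
      finally have "h * (?s * (e i n - ?S - L1_coeff \<alpha> (n - 1) * e i 0))
          \<le> 1 / c * (?s * (F i - F (i - 1)) + h * \<rho>)" .
      moreover have "h * \<bar>e i n\<bar> \<le> h * (?S' + L1_coeff \<alpha> (n - 1) * \<bar>e i 0\<bar>
          + ?s * (e i n - ?S - L1_coeff \<alpha> (n - 1) * e i 0))"
        using pos * by (intro mult_left_mono) auto
      moreover have "h * ?S' = (\<Sum>k = 1..<n. A k * (h * \<bar>e i k\<bar>))"
        by (simp add: sum_distrib_left mult_ac)
      ultimately show ?thesis
        by (simp only: distrib_left mult.left_commute[of h])
    qed
    then have "(\<Sum>i = 1..N. h * \<bar>e i n\<bar>) \<le> (\<Sum>i = 1..N. (\<Sum>k = 1..<n. A k * (h * \<bar>e i k\<bar>))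
        + L1_coeff \<alpha> (n - 1) * (h * \<bar>e i 0\<bar>) + 1 / c * (sgn (e i n) * (F i - F (i - 1)) + h * \<rho>))"
      by (rule sum_mono)
    also have "\<dots> = (\<Sum>k = 1..<n. A k * E k) + L1_coeff \<alpha> (n - 1) * E 0
        + 1 / c * ((\<Sum>i = 1..N. sgn (e i n) * (F i - F (i - 1))) + real N * h * \<rho>)"
      unfolding E_def discrete_L1_norm_def sum.distrib
      by (subst sum.swap) (simp add: sum_distrib_left sum.distrib add_divide_distrib sum_divide_distrib)
    \<comment> \<open>The scheme is implicit: the fluxes are taken only at the level
      \<open>n \<ge> 1\<close>, where the boundary errors are zero. The boundary entries of
      \<open>e\<close> at level 0 do not enter.\<close>
    also have "\<dots> \<le> (\<Sum>k = 1..<n. A k * E k) + L1_coeff \<alpha> (n - 1) * E 0 + 1 / c * (real N * h * \<rho>)"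
    proof -
      have "(\<Sum>i = 1..N. sgn (e i n) * (F i - F (i - 1))) \<le> 0"
        using pq bdry[OF n] by (intro sum_sgn_flux_difference_nonpos[where p=p and q=q]) (auto simp: F_def)
      then show ?thesis
        using c by (intro add_left_mono mult_left_mono) auto
    qed
    finally show "E n \<le> (\<Sum>k = 1..<n. (L1_coeff \<alpha> (n - k - 1) - L1_coeff \<alpha> (n - k)) * E k)
        + L1_coeff \<alpha> (n - 1) * E 0 + 1 / c * (real N * h * \<rho>)"
      by (simp add: E_def discrete_L1_norm_def A_def)
  qed
  then show ?thesis
    unfolding c_inv E_def .
qed

section \<open>Error of the L1 formula\<close>

lemma has_integral_weakly_singular_kernel:
  fixes c d t \<alpha> :: real
  assumes "\<alpha> < 1" "c \<le> d" "d \<le> t"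
  shows "((\<lambda>\<eta>. 1 / (t - \<eta>) powr \<alpha>) has_integral
    ((t - c) powr (1 - \<alpha>) - (t - d) powr (1 - \<alpha>)) / (1 - \<alpha>)) {c..d}"
proof -
  let ?P = "\<lambda>\<eta>. - ((t - \<eta>) powr (1 - \<alpha>)) / (1 - \<alpha>)"
  have "((\<lambda>\<eta>. 1 / (t - \<eta>) powr \<alpha>) has_integral ?P d - ?P c) {c..d}"
  \<comment> \<open>For \<open>d = t\<close> the antiderivative is not differentiable at the right
    end point, but it is continuous there since \<open>1 - \<alpha> > 0\<close>; the interior form
    of the fundamental theorem covers this case.\<close>
  proof (rule fundamental_theorem_of_calculus_interior)
    show "continuous_on {c..d} ?P"
      using assms by (intro continuous_on_powr' continuous_intros) auto
    fix x assume "x \<in> {c<..<d}"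
    then have "0 < t - x" using assms by auto
    then have "(?P has_real_derivative 1 / (t - x) powr \<alpha>) (at x)"
      using assms by (auto intro!: derivative_eq_intros simp: powr_minus_divide)
    then show "(?P has_vector_derivative 1 / (t - x) powr \<alpha>) (at x)"
      by (simp add: has_real_derivative_iff_has_vector_derivative)
  qed (use assms in auto)
  then show ?thesis
    by (simp add: diff_divide_distrib)
qed

lemma integrable_continuous_times_kernel:
  fixes g :: "real \<Rightarrow> real"
  assumes "\<alpha> < 1" "c \<le> d" "d \<le> t" "continuous_on {c..d} g"
  shows "(\<lambda>\<eta>. g \<eta> / (t - \<eta>) powr \<alpha>) integrable_on {c..d}"
proof -
  have "(\<lambda>\<eta>. 1 / (t - \<eta>) powr \<alpha>) absolutely_integrable_on {c..d}"
    using has_integral_weakly_singular_kernel[OF assms(1-3)]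
    by (intro nonnegative_absolutely_integrable_1) auto
  then have "(\<lambda>\<eta>. g \<eta> * (1 / (t - \<eta>) powr \<alpha>)) absolutely_integrable_on {c..d}"
    using assms(4)
    by (intro absolutely_integrable_bounded_measurable_product_real
        continuous_imp_measurable_on_sets_lebesgue compact_imp_bounded compact_continuous_image) auto
  then show ?thesis
    using absolutely_integrable_on_def by auto
qed

text \<open>\<open>caputo\<close> is defined with the two-sided \<open>deriv\<close>, whereas
  smoothness on the closed rectangle provides derivatives relative to \<open>{0..T}\<close>. The two
  agree except possibly at \<open>0\<close> and \<open>t\<close>, a null set.\<close>

lemma caputo_eq_integral:
  assumes u: "\<And>s. s \<in> {0..T} \<Longrightarrow> (u has_real_derivative u' s) (at s within {0..T})"
    and "t \<le> T"
  shows "caputo \<alpha> u t = 1 / Gamma (1 - \<alpha>) * integral {0..t} (\<lambda>\<eta>. u' \<eta> / (t - \<eta>) powr \<alpha>)"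
proof -
  have "deriv u \<eta> = u' \<eta>" if "\<eta> \<in> {0..t} - {0, t}" for \<eta>
  proof -
    have "at \<eta> within {0..T} = at \<eta>"
      using that assms(2) by (intro at_within_interior) auto
    with u[of \<eta>] show ?thesis
      using that assms(2) by (auto intro: DERIV_imp_deriv)
  qed
  then have "integral {0..t} (\<lambda>\<eta>. deriv u \<eta> / (t - \<eta>) powr \<alpha>) =
      integral {0..t} (\<lambda>\<eta>. u' \<eta> / (t - \<eta>) powr \<alpha>)"
    by (intro integral_spike[of "{0, t}"]) auto
  then show ?thesis
    by (simp add: caputo_def)
qed

text \<open>The direct estimate by the integral of the kernel. It serves on the last time step,
  where the kernel is unbounded, and over the whole interval \<open>{0..t}\<close>.\<close>

lemma abs_integral_kernel_le:
  fixes g :: "real \<Rightarrow> real"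
  assumes "\<alpha> < 1" "c \<le> d" "d \<le> t" "continuous_on {c..d} g"
    and B: "\<And>\<eta>. \<eta> \<in> {c..d} \<Longrightarrow> \<bar>g \<eta>\<bar> \<le> B"
  shows "\<bar>integral {c..d} (\<lambda>\<eta>. g \<eta> / (t - \<eta>) powr \<alpha>)\<bar>
    \<le> B * (((t - c) powr (1 - \<alpha>) - (t - d) powr (1 - \<alpha>)) / (1 - \<alpha>))"
proof -
  note K = has_integral_mult_right[OF has_integral_weakly_singular_kernel[OF assms(1-3)], of B]
  have "\<bar>integral {c..d} (\<lambda>\<eta>. g \<eta> / (t - \<eta>) powr \<alpha>)\<bar>
      \<le> integral {c..d} (\<lambda>\<eta>. B * (1 / (t - \<eta>) powr \<alpha>))"
    unfolding real_norm_def[symmetric]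
  proof (rule Henstock_Kurzweil_Integration.integral_norm_bound_integral)
    fix \<eta> assume "\<eta> \<in> {c..d}"
    then have "\<bar>g \<eta>\<bar> * (1 / (t - \<eta>) powr \<alpha>) \<le> B * (1 / (t - \<eta>) powr \<alpha>)"
      by (intro mult_right_mono B) auto
    then show "norm (g \<eta> / (t - \<eta>) powr \<alpha>) \<le> B * (1 / (t - \<eta>) powr \<alpha>)"
      by simp
  qed (use integrable_continuous_times_kernel[OF assms(1-4)] has_integral_integrable[OF K] in auto)
  then show ?thesis
    using integral_unique[OF K] by simp
qed

lemma integral_combine_uniform_partition:
  fixes g :: "real \<Rightarrow> real"
  assumes "0 \<le> \<tau>" "g integrable_on {0..real n * \<tau>}"
  shows "integral {0..real n * \<tau>} g = (\<Sum>k<n. integral {real k * \<tau>..real (k + 1) * \<tau>} g)"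
  using assms(2)
proof (induction n)
  case (Suc n)
  have le: "real n * \<tau> \<le> real (Suc n) * \<tau>"
    using assms(1) by (intro mult_right_mono) auto
  have "g integrable_on {0..real n * \<tau>}"
    using Suc.prems le by (rule_tac integrable_subinterval_real) auto
  then show ?case
    using Suc.IH Henstock_Kurzweil_Integration.integral_combine[OF _ le Suc.prems] assms(1) by (simp add: add.commute)
qed simp

text \<open>Away from the singularity the mean-free factor \<open>u' - \<delta>\<close> allows the value of the kernel at the
  left end point to be subtracted, so that only the increment of the kernel contributes; these
  increments telescope over the time steps.\<close>

lemma abs_integral_mean_free_le:
  fixes u u' :: "real \<Rightarrow> real"
  assumes "0 < \<alpha>" "\<alpha> < 1" "c < d" "d < t"
    and u: "\<And>s. s \<in> {c..d} \<Longrightarrow> (u has_real_derivative u' s) (at s within {c..d})"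
    and cont: "continuous_on {c..d} u'"
    and \<delta>: "\<delta> = (u d - u c) / (d - c)"
    and B: "\<And>s. s \<in> {c..d} \<Longrightarrow> \<bar>u' s - \<delta>\<bar> \<le> B"
  shows "\<bar>integral {c..d} (\<lambda>\<eta>. (u' \<eta> - \<delta>) / (t - \<eta>) powr \<alpha>)\<bar>
    \<le> B * (1 / (t - d) powr \<alpha> - 1 / (t - c) powr \<alpha>) * (d - c)"
proof -
  let ?K = "\<lambda>\<eta>. 1 / (t - \<eta>) powr \<alpha>"
  have int: "(\<lambda>\<eta>. (u' \<eta> - \<delta>) / (t - \<eta>) powr \<alpha>) integrable_on {c..d}"
    using assms by (intro integrable_continuous_times_kernel continuous_intros) auto
  have "(u' has_integral u d - u c) {c..d}"
    using assms(3) u by (intro fundamental_theorem_of_calculus)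
      (auto simp: has_real_derivative_iff_has_vector_derivative)
  from has_integral_diff[OF this has_integral_const_real[of \<delta> c d]]
  have "((\<lambda>\<eta>. u' \<eta> - \<delta>) has_integral 0) {c..d}"
    using assms(3) by (simp add: \<delta>)
  from has_integral_diff[OF integrable_integral[OF int] has_integral_mult_right[OF this, of "?K c"]]
  have *: "((\<lambda>\<eta>. (u' \<eta> - \<delta>) * (?K \<eta> - ?K c)) has_integral
      integral {c..d} (\<lambda>\<eta>. (u' \<eta> - \<delta>) / (t - \<eta>) powr \<alpha>)) (cbox c d)"
    by (simp add: algebra_simps)
  have "0 \<le> B"
    using B[of c] assms(3) by auto
  have mono: "?K x \<le> ?K y" if "x \<le> y" "y \<le> d" for x y
    using that assms by (intro divide_left_mono powr_mono2 mult_pos_pos) auto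
  have "norm (integral {c..d} (\<lambda>\<eta>. (u' \<eta> - \<delta>) / (t - \<eta>) powr \<alpha>))
      \<le> B * (?K d - ?K c) * measure lborel (cbox c d)"
  proof (rule has_integral_bound[OF _ *])
    show "0 \<le> B * (?K d - ?K c)"
      using mono[of c d] assms(3) \<open>0 \<le> B\<close> by simp
    fix x assume "x \<in> cbox c d"
    then show "norm ((u' x - \<delta>) * (?K x - ?K c)) \<le> B * (?K d - ?K c)"
      using mono[of c x] mono[of x d] B[of x] \<open>0 \<le> B\<close>
      by (auto simp: abs_mult intro!: mult_mono)
  qed
  then show ?thesis
    using assms(3) by simp
qed

text \<open>Replacing \<open>u'\<close> on each time step by the difference quotient and integrating
  the kernel exactly gives the L1 formula, so the error is the sum of the
  \<open>\<epsilon> k\<close>. The steps before the last contribute kernel increments that telescope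
  to at most \<open>\<tau> powr (- \<alpha>)\<close>, with the factor
  \<open>M * \<tau> * \<tau>\<close>; the last step contributes
  \<open>M * \<tau> * \<tau> powr (1 - \<alpha>) / (1 - \<alpha>)\<close>. Both are of order
  \<open>2 - \<alpha>\<close>.\<close>

lemma L1_formula_error:
  fixes u u' :: "real \<Rightarrow> real"
  assumes \<alpha>: "0 < \<alpha>" "\<alpha> < 1" and "0 < \<tau>" "1 \<le> n" "real n * \<tau> \<le> T"
    and u: "\<And>s. s \<in> {0..T} \<Longrightarrow> (u has_real_derivative u' s) (at s within {0..T})"
    and lip: "\<And>s r. s \<in> {0..T} \<Longrightarrow> r \<in> {0..T} \<Longrightarrow> \<bar>u' s - u' r\<bar> \<le> M * \<bar>s - r\<bar>"
  shows "\<bar>caputo \<alpha> u (real n * \<tau>) - \<tau> powr (- \<alpha>) / Gamma (2 - \<alpha>) *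
      (u (real n * \<tau>)
        - (\<Sum>k = 1..<n. (L1_coeff \<alpha> (n - k - 1) - L1_coeff \<alpha> (n - k)) * u (real k * \<tau>))
        - L1_coeff \<alpha> (n - 1) * u 0)\<bar>
    \<le> M * \<tau> powr (2 - \<alpha>) * ((1 + 1 / (1 - \<alpha>)) / Gamma (1 - \<alpha>))"
proof -
  define t where "t = real n * \<tau>"
  define g where "g k = real k * \<tau>" for k
  define \<delta> where "\<delta> k = (u (g (k + 1)) - u (g k)) / \<tau>" for k
  have g_diff: "g (k + 1) - g k = \<tau>" and g_less: "g k < g (k + 1)" for k
    using \<open>0 < \<tau>\<close> by (auto simp: g_def algebra_simps)
  have g0: "g 0 = 0" and gn: "g n = t" by (auto simp: g_def t_def)
  have g_mono: "g j \<le> g k" if "j \<le> k" for j k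
    using that \<open>0 < \<tau>\<close> by (auto simp: g_def)
  have g_le: "0 \<le> g k" for k
    using \<open>0 < \<tau>\<close> by (auto simp: g_def)
  have "t \<le> T" using assms by (simp add: t_def)
  have sub: "{g k..g (k + 1)} \<subseteq> {0..T}" if "k < n" for k
    using g_le[of k] g_mono[of "k + 1" n] that \<open>t \<le> T\<close> gn by auto
  have cont: "continuous_on {0..T} u'"
  proof (rule lipschitz_on_continuous_on)
    show "\<bar>M\<bar>-lipschitz_on {0..T} u'"
    proof (rule lipschitz_onI)
      fix x y assume "x \<in> {0..T}" "y \<in> {0..T}"
      then have "\<bar>u' x - u' y\<bar> \<le> M * \<bar>x - y\<bar>"
        by (rule lip)
      also have "\<dots> \<le> \<bar>M\<bar> * \<bar>x - y\<bar>" by (intro mult_right_mono) auto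
      finally show "dist (u' x) (u' y) \<le> \<bar>M\<bar> * dist x y" by (simp add: dist_real_def)
    qed simp
  qed
  have "0 \<le> M"
  proof -
    have "0 < t" using \<open>0 < \<tau>\<close> \<open>1 \<le> n\<close> by (simp add: t_def)
    moreover from this have "0 \<le> M * t"
      using order_trans[OF abs_ge_zero lip[of 0 t]] \<open>t \<le> T\<close> by simp
    ultimately show ?thesis by (simp add: zero_le_mult_iff)
  qed
  \<comment> \<open>The difference quotient is a value of \<open>u'\<close> at some point of the
    same time step, hence within \<open>M * \<tau>\<close> of every other value there.\<close>
  have \<delta>_err: "\<bar>u' s - \<delta> k\<bar> \<le> M * \<tau>" if k: "k < n" and s: "s \<in> {g k..g (k + 1)}" for k s
  proof -
    have "\<exists>z\<in>{g k..g (k + 1)}. u (g (k + 1)) - u (g k) = u' z * (g (k + 1) - g k)"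
    proof (rule mvt_very_simple)
      fix x assume "g k \<le> x" "x \<le> g (k + 1)"
      then show "(u has_derivative (*) (u' x)) (at x within {g k..g (k + 1)})"
        using u[of x] sub[OF k] by (auto simp: has_field_derivative_def intro: has_derivative_subset)
    qed (use g_less[of k] in simp)
    then obtain z where z: "z \<in> {g k..g (k + 1)}" "\<delta> k = u' z"
      using \<open>0 < \<tau>\<close> unfolding g_diff \<delta>_def by auto
    have "\<bar>u' s - u' z\<bar> \<le> M * \<bar>s - z\<bar>"
      using sub[OF k] s z by (intro lip) auto
    also have "\<dots> \<le> M * \<tau>"
      using s z g_diff[of k] \<open>0 \<le> M\<close> by (intro mult_left_mono) auto
    finally show ?thesis by (simp add: z)
  qed
  let ?K = "\<lambda>\<eta>. 1 / (t - \<eta>) powr \<alpha>"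
  define \<epsilon> where "\<epsilon> k = integral {g k..g (k + 1)} (\<lambda>\<eta>. (u' \<eta> - \<delta> k) / (t - \<eta>) powr \<alpha>)" for k
  have eps: "integral {g k..g (k + 1)} (\<lambda>\<eta>. u' \<eta> / (t - \<eta>) powr \<alpha>) =
      \<tau> powr (- \<alpha>) / (1 - \<alpha>) * (L1_coeff \<alpha> (n - k - 1) * (u (g (k + 1)) - u (g k))) + \<epsilon> k"
    if k: "k < n" for k
  proof -
    have le: "g (k + 1) \<le> t"
      using g_mono[of "k + 1" n] k gn by simp
    note 1 = has_integral_weakly_singular_kernel[OF \<alpha>(2) less_imp_le[OF g_less] le]
    have 2: "(\<lambda>\<eta>. (u' \<eta> - \<delta> k) / (t - \<eta>) powr \<alpha>) integrable_on {g k..g (k + 1)}"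
      using continuous_on_subset[OF cont sub[OF k]] le g_less[of k] \<alpha>
      by (intro integrable_continuous_times_kernel continuous_intros) auto
    have nk: "t - g k = (real (n - k - 1) + 1) * \<tau>" "t - g (k + 1) = real (n - k - 1) * \<tau>"
      using k by (auto simp: t_def g_def of_nat_diff algebra_simps)
    have "integral {g k..g (k + 1)} (\<lambda>\<eta>. u' \<eta> / (t - \<eta>) powr \<alpha>) =
       \<delta> k * (((t - g k) powr (1 - \<alpha>) - (t - g (k + 1)) powr (1 - \<alpha>)) / (1 - \<alpha>)) + \<epsilon> k"
      using has_integral_add[OF has_integral_mult_right[OF 1, of "\<delta> k"] integrable_integral[OF 2]]
      by (intro integral_unique) (simp add: diff_divide_distrib \<epsilon>_def)
    also have "((t - g k) powr (1 - \<alpha>) - (t - g (k + 1)) powr (1 - \<alpha>)) = \<tau> powr (1 - \<alpha>) * L1_coeff \<alpha> (n - k - 1)"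
      using \<open>0 < \<tau>\<close> unfolding nk by (simp add: L1_coeff_def powr_mult right_diff_distrib mult.commute)
    also have "\<tau> powr (1 - \<alpha>) = \<tau> * \<tau> powr (- \<alpha>)"
      using \<open>0 < \<tau>\<close> powr_add[of \<tau> 1 "- \<alpha>"] by simp
    finally show ?thesis
      using \<open>0 < \<tau>\<close> by (simp add: \<delta>_def mult_ac)
  qed
  \<comment> \<open>The index \<open>m\<close> is that of the last time step, which ends at the
    singularity \<open>t\<close>; all earlier steps end strictly before \<open>t\<close>.\<close>
  obtain m where m: "n = Suc m" using \<open>1 \<le> n\<close> by (cases n) auto
  have eps_le: "\<bar>\<epsilon> k\<bar> \<le> M * \<tau> * (?K (g (k + 1)) - ?K (g k)) * \<tau>" if "k < m" for k
  proof -
    have "k < n" "g (k + 1) < t"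
      using that g_mono[of "k + 1" m] g_less[of m] by (auto simp: m gn[symmetric])
    note k = this
    show ?thesis
      unfolding \<epsilon>_def
      using abs_integral_mean_free_le[OF \<alpha> g_less k(2), of u u' "\<delta> k" "M * \<tau>"] \<delta>_err[OF k(1)]
        u[THEN has_field_derivative_subset] sub[OF k(1)] continuous_on_subset[OF cont sub[OF k(1)]]
      unfolding g_diff \<delta>_def by blast
  qed
  have eps_m: "\<bar>\<epsilon> m\<bar> \<le> M * \<tau> * (\<tau> powr (1 - \<alpha>) / (1 - \<alpha>))"
  proof -
    have m_less: "m < n" and t: "g (m + 1) = t" "t - g m = \<tau>"
      using gn g_diff[of m] by (auto simp: m)
    have "\<bar>\<epsilon> m\<bar> \<le> M * \<tau> * (((t - g m) powr (1 - \<alpha>) - (t - g (m + 1)) powr (1 - \<alpha>)) / (1 - \<alpha>))"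
      unfolding \<epsilon>_def
    proof (rule abs_integral_kernel_le[OF \<alpha>(2) less_imp_le[OF g_less]])
      show "continuous_on {g m..g (m + 1)} (\<lambda>\<eta>. u' \<eta> - \<delta> m)"
        by (intro continuous_intros continuous_on_subset[OF cont sub[OF m_less]])
    qed (use t(1) \<delta>_err[OF m_less] in auto)
    then show ?thesis
      unfolding t by simp
  qed
  have "\<bar>\<Sum>k<n. \<epsilon> k\<bar> \<le> (\<Sum>k<m. \<bar>\<epsilon> k\<bar>) + \<bar>\<epsilon> m\<bar>"
    unfolding m by (simp add: order_trans[OF abs_triangle_ineq])
  also have "(\<Sum>k<m. \<bar>\<epsilon> k\<bar>) \<le> (\<Sum>k<m. M * \<tau> * (?K (g (k + 1)) - ?K (g k)) * \<tau>)"
    using eps_le by (intro sum_mono) auto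
  also have "\<dots> = M * \<tau> * (?K (g m) - ?K (g 0)) * \<tau>"
    using sum_lessThan_telescope[of "\<lambda>k. ?K (g k)" m]
    by (simp only: sum_distrib_right[symmetric] sum_distrib_left[symmetric] Suc_eq_plus1[symmetric])
  \<comment> \<open>The kernel value at time 0 is nonnegative and is dropped. The remaining value is
    taken at distance exactly \<open>\<tau>\<close> from the singularity.\<close>
  also have "\<dots> \<le> M * \<tau> * ?K (g m) * \<tau>"
    using \<open>0 \<le> M\<close> \<open>0 < \<tau>\<close> by (intro mult_right_mono mult_left_mono) auto
  also have "?K (g m) = \<tau> powr (- \<alpha>)"
    using gn g_diff[of m] by (simp add: m powr_minus_divide)
  finally have "\<bar>\<Sum>k<n. \<epsilon> k\<bar> \<le> M * \<tau> * \<tau> powr (- \<alpha>) * \<tau> + M * \<tau> * (\<tau> powr (1 - \<alpha>) / (1 - \<alpha>))"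
    using eps_m by simp
  also have "M * \<tau> * \<tau> powr (- \<alpha>) * \<tau> = M * \<tau> powr (2 - \<alpha>)"
    using \<open>0 < \<tau>\<close> powr_add[of \<tau> 2 "- \<alpha>"] by (simp add: power2_eq_square)
  also have "M * \<tau> * (\<tau> powr (1 - \<alpha>) / (1 - \<alpha>)) = M * \<tau> powr (2 - \<alpha>) * (1 / (1 - \<alpha>))"
    using \<open>0 < \<tau>\<close> powr_add[of \<tau> 1 "1 - \<alpha>"] by simp
  finally have eps_sum: "\<bar>\<Sum>k<n. \<epsilon> k\<bar> \<le> M * \<tau> powr (2 - \<alpha>) * (1 + 1 / (1 - \<alpha>))"
    by (simp add: algebra_simps)
  have Gpos: "0 < Gamma (1 - \<alpha>)"
    using \<alpha> by (intro Gamma_real_pos) auto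
  have G2: "Gamma (2 - \<alpha>) = (1 - \<alpha>) * Gamma (1 - \<alpha>)"
    using Gamma_plus1[of "1 - \<alpha>"] nonpos_Ints_nonpos[of "1 - \<alpha>"] \<alpha> by fastforce
  have "integral {0..t} (\<lambda>\<eta>. u' \<eta> / (t - \<eta>) powr \<alpha>) =
      (\<Sum>k<n. integral {g k..g (k + 1)} (\<lambda>\<eta>. u' \<eta> / (t - \<eta>) powr \<alpha>))"
    unfolding t_def g_def
    using \<alpha> \<open>0 < \<tau>\<close> continuous_on_subset[OF cont, of "{0..t}"] \<open>t \<le> T\<close>
    by (intro integral_combine_uniform_partition integrable_continuous_times_kernel) (auto simp: t_def)
  also have "\<dots> = \<tau> powr (- \<alpha>) / (1 - \<alpha>) * (\<Sum>k<n. L1_coeff \<alpha> (n - k - 1) * (u (g (k + 1)) - u (g k))) + (\<Sum>k<n. \<epsilon> k)"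
    using eps by (simp add: sum.distrib sum_distrib_left)
  also have "(\<Sum>k<n. L1_coeff \<alpha> (n - k - 1) * (u (g (k + 1)) - u (g k))) =
      u t - (\<Sum>k = 1..<n. (L1_coeff \<alpha> (n - k - 1) - L1_coeff \<alpha> (n - k)) * u (g k)) - L1_coeff \<alpha> (n - 1) * u 0"
    using L1_coeff_summation_by_parts[OF \<open>1 \<le> n\<close>, of \<alpha> "\<lambda>k. u (g k)"] by (simp add: gn g0)
  finally have int_eq: "integral {0..t} (\<lambda>\<eta>. u' \<eta> / (t - \<eta>) powr \<alpha>) = \<tau> powr (- \<alpha>) / (1 - \<alpha>) *
      (u t - (\<Sum>k = 1..<n. (L1_coeff \<alpha> (n - k - 1) - L1_coeff \<alpha> (n - k)) * u (g k)) - L1_coeff \<alpha> (n - 1) * u 0)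
      + (\<Sum>k<n. \<epsilon> k)" .
  have "caputo \<alpha> u t = 1 / Gamma (1 - \<alpha>) * integral {0..t} (\<lambda>\<eta>. u' \<eta> / (t - \<eta>) powr \<alpha>)"
    using u \<open>t \<le> T\<close> by (rule caputo_eq_integral)
  then have "caputo \<alpha> u t - \<tau> powr (- \<alpha>) / Gamma (2 - \<alpha>) *
      (u t - (\<Sum>k = 1..<n. (L1_coeff \<alpha> (n - k - 1) - L1_coeff \<alpha> (n - k)) * u (g k)) - L1_coeff \<alpha> (n - 1) * u 0)
      = 1 / Gamma (1 - \<alpha>) * (\<Sum>k<n. \<epsilon> k)"
    unfolding int_eq G2 by (simp add: distrib_left mult_ac)
  also have "\<bar>\<dots>\<bar> \<le> 1 / Gamma (1 - \<alpha>) * (M * \<tau> powr (2 - \<alpha>) * (1 + 1 / (1 - \<alpha>)))"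
    using Gpos eps_sum unfolding abs_mult by (intro mult_mono) auto
  finally show ?thesis
    unfolding t_def g_def by (simp add: mult_ac)
qed

section \<open>Consistency in space\<close>

lemma has_real_derivative_compose_affine:
  fixes g :: "real \<Rightarrow> real"
  assumes "(g has_real_derivative d) (at (m + c * r) within S)"
    and "\<And>x. x \<in> R \<Longrightarrow> m + c * x \<in> S"
  shows "((\<lambda>x. g (m + c * x)) has_real_derivative c * d) (at r within R)"
proof -
  have "(g has_real_derivative d) (at (m + c * r) within (\<lambda>x. m + c * x) ` R)"
    using assms by (intro has_field_derivative_subset[OF assms(1)]) auto
  moreover have "((\<lambda>x. m + c * x) has_real_derivative c) (at r within R)"
    by (auto intro!: derivative_eq_intros)
  ultimately show ?thesis
    using DERIV_image_chain[of g d "\<lambda>x. m + c * x" r R c] by (simp add: o_def mult.commute)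
qed

text \<open>The derivative of \<open>g (m + r) + g (m - r)\<close> in \<open>r\<close> is
  \<open>g' (m + r) - g' (m - r)\<close>, of size at most \<open>2 * B * r\<close>. Its uniform
  bound \<open>2 * B * s\<close> on \<open>{0..s}\<close> is used, which costs a factor 2 against
  the sharp constant. The factors \<open>1\<close> and \<open>-1\<close> in the proof match the
  affine form \<open>m + c * r\<close>.\<close>

lemma second_difference_le:
  fixes g :: "real \<Rightarrow> real"
  assumes g': "\<And>x. x \<in> {p..q} \<Longrightarrow> (g has_real_derivative g' x) (at x within {p..q})"
    and g'': "\<And>x. x \<in> {p..q} \<Longrightarrow> (g' has_real_derivative g'' x) (at x within {p..q})"
    and B: "\<And>x. x \<in> {p..q} \<Longrightarrow> \<bar>g'' x\<bar> \<le> B"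
    and s: "0 \<le> s" "p \<le> m - s" "m + s \<le> q"
  shows "\<bar>g (m + s) + g (m - s) - 2 * g m\<bar> \<le> 2 * B * s^2"
proof -
  have "0 \<le> B"
    using B[of m] s by auto
  have der: "((\<lambda>r. g (m + 1 * r) + g (m + (-1) * r)) has_real_derivative 1 * g' (m + 1 * r) + (-1) * g' (m + (-1) * r))
      (at r within {0..s})" if "r \<in> {0..s}" for r
    using s that by (intro DERIV_add has_real_derivative_compose_affine[where S = "{p..q}"] g') auto
  have "norm ((g (m + 1 * s) + g (m + (-1) * s)) - (g (m + 1 * 0) + g (m + (-1) * 0))) \<le> (2 * B * s) * norm (s - 0)"
  proof (rule field_differentiable_bound[OF _ der])
    fix r assume r: "r \<in> {0..s}"
    have "norm (g' (m + r) - g' (m - r)) \<le> B * norm ((m + r) - (m - r))"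
      by (rule field_differentiable_bound[of "{p..q}", OF _ g'']) (use B r s in auto)
    also have "\<dots> \<le> B * (2 * s)"
      using r \<open>0 \<le> B\<close> by (intro mult_left_mono) auto
    finally show "norm (1 * g' (m + 1 * r) + (-1) * g' (m + (-1) * r)) \<le> 2 * B * s"
      by (simp add: mult_ac)
  qed (use s in auto)
  then show ?thesis
    using s by (simp add: power2_eq_square mult_ac)
qed

text \<open>The hypothesis is a bound on second differences of \<open>g'\<close> rather than on a
  third derivative. In this form it applies to \<open>\<kappa> * wx - f * w\<close>, whose
  derivative is a Caputo derivative with controlled second differences.\<close>

lemma central_difference_le:
  fixes g :: "real \<Rightarrow> real"
  assumes g': "\<And>x. x \<in> {p..q} \<Longrightarrow> (g has_real_derivative g' x) (at x within {p..q})"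
    and D: "\<And>r. 0 \<le> r \<Longrightarrow> r \<le> s \<Longrightarrow> \<bar>g' (m + r) + g' (m - r) - 2 * g' m\<bar> \<le> D"
    and s: "0 \<le> s" "p \<le> m - s" "m + s \<le> q"
  shows "\<bar>g (m + s) - g (m - s) - 2 * s * g' m\<bar> \<le> D * s"
proof -
  have der: "((\<lambda>r. g (m + 1 * r) - g (m + (-1) * r) - 2 * r * g' m) has_real_derivative
      1 * g' (m + 1 * r) - (-1) * g' (m + (-1) * r) - 2 * g' m) (at r within {0..s})" if "r \<in> {0..s}" for r
    using s that by (intro DERIV_diff has_real_derivative_compose_affine[where S = "{p..q}"] g')
      (auto intro!: derivative_eq_intros)
  have "norm ((g (m + 1 * s) - g (m + (-1) * s) - 2 * s * g' m) - (g (m + 1 * 0) - g (m + (-1) * 0) - 2 * 0 * g' m))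
      \<le> D * norm (s - 0)"
    by (rule field_differentiable_bound[OF _ der]) (use D s in auto)
  then show ?thesis
    using s by simp
qed

text \<open>Allows the difference estimates to be applied to \<open>g (x + h) - g x\<close> on
  \<open>{a..b - h}\<close>. As a forward difference is bounded by \<open>h\<close> times a
  derivative, differences of errors over a cell gain one power of \<open>h\<close>.\<close>

lemma has_real_derivative_forward_difference:
  fixes g :: "real \<Rightarrow> real"
  assumes g': "\<And>x. x \<in> {a..b} \<Longrightarrow> (g has_real_derivative g' x) (at x within {a..b})"
    and "0 \<le> h" "x \<in> {a..b - h}"
  shows "((\<lambda>x. g (x + h) - g x) has_real_derivative g' (x + h) - g' x) (at x within {a..b - h})"
proof -
  have "((\<lambda>x. g (h + 1 * x)) has_real_derivative 1 * g' (h + 1 * x)) (at x within {a..b - h})"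
    using assms by (intro has_real_derivative_compose_affine[where S = "{a..b}"] g') auto
  moreover have "(g has_real_derivative g' x) (at x within {a..b - h})"
    using assms by (intro has_field_derivative_subset[OF g']) auto
  ultimately show ?thesis
    using DERIV_diff by (simp add: add.commute)
qed

lemma abs_forward_difference_le:
  fixes g :: "real \<Rightarrow> real"
  assumes g': "\<And>x. x \<in> {a..b} \<Longrightarrow> (g has_real_derivative g' x) (at x within {a..b})"
    and "\<And>x. x \<in> {a..b} \<Longrightarrow> \<bar>g' x\<bar> \<le> B" and "0 \<le> h" "x \<in> {a..b - h}"
  shows "\<bar>g (x + h) - g x\<bar> \<le> B * h"
  using field_differentiable_bound[of "{a..b}" g g' B "x + h" x] assms by auto

text \<open>The second difference in space passes under the time integral and acts on
  \<open>wt\<close>, where it is at most \<open>2 * B * r^2\<close>. The kernel has integral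
  \<open>t powr (1 - \<alpha>) / (1 - \<alpha>)\<close>, which is increasing in
  \<open>t\<close>.\<close>

lemma caputo_second_difference_le:
  fixes w wt wtx wtxx :: "real \<Rightarrow> real \<Rightarrow> real"
  assumes \<alpha>: "0 < \<alpha>" "\<alpha> < 1" and t: "0 \<le> t" "t \<le> T"
    and wt: "\<And>x s. x \<in> {a..b} \<Longrightarrow> s \<in> {0..T} \<Longrightarrow> (w x has_real_derivative wt x s) (at s within {0..T})"
    and cont: "\<And>x. x \<in> {a..b} \<Longrightarrow> continuous_on {0..T} (wt x)"
    and wtx: "\<And>x s. x \<in> {a..b} \<Longrightarrow> s \<in> {0..T} \<Longrightarrow>
      ((\<lambda>y. wt y s) has_real_derivative wtx x s) (at x within {a..b})"
    and wtxx: "\<And>x s. x \<in> {a..b} \<Longrightarrow> s \<in> {0..T} \<Longrightarrow>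
      ((\<lambda>y. wtx y s) has_real_derivative wtxx x s) (at x within {a..b})"
    and B: "\<And>x s. x \<in> {a..b} \<Longrightarrow> s \<in> {0..T} \<Longrightarrow> \<bar>wtxx x s\<bar> \<le> B"
    and r: "0 \<le> r" "a \<le> x - r" "x + r \<le> b"
  shows "\<bar>caputo \<alpha> (w (x + r)) t + caputo \<alpha> (w (x - r)) t - 2 * caputo \<alpha> (w x) t\<bar>
    \<le> 2 * B * r^2 * (T powr (1 - \<alpha>) / ((1 - \<alpha>) * Gamma (1 - \<alpha>)))"
proof -
  let ?K = "\<lambda>\<eta>. (t - \<eta>) powr \<alpha>"
  have mem: "x + r \<in> {a..b}" "x - r \<in> {a..b}" "x \<in> {a..b}"
    using r by auto
  have cap: "caputo \<alpha> (w y) t = 1 / Gamma (1 - \<alpha>) * integral {0..t} (\<lambda>\<eta>. wt y \<eta> / ?K \<eta>)"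
    if "y \<in> {a..b}" for y
    by (rule caputo_eq_integral[OF _ t(2)]) (rule wt[OF that])
  have cont_t: "continuous_on {0..t} (wt y)" if "y \<in> {a..b}" for y
    using t by (intro continuous_on_subset[OF cont[OF that]]) auto
  have int: "((\<lambda>\<eta>. wt y \<eta> / ?K \<eta>) has_integral integral {0..t} (\<lambda>\<eta>. wt y \<eta> / ?K \<eta>)) {0..t}"
    if "y \<in> {a..b}" for y
    using \<alpha> t by (intro integrable_integral integrable_continuous_times_kernel cont_t that) auto
  have "((\<lambda>\<eta>. (wt (x + r) \<eta> + wt (x - r) \<eta> - 2 * wt x \<eta>) / ?K \<eta>) has_integral
      integral {0..t} (\<lambda>\<eta>. wt (x + r) \<eta> / ?K \<eta>) + integral {0..t} (\<lambda>\<eta>. wt (x - r) \<eta> / ?K \<eta>)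
      - 2 * integral {0..t} (\<lambda>\<eta>. wt x \<eta> / ?K \<eta>)) {0..t}"
    using has_integral_diff[OF has_integral_add[OF int[OF mem(1)] int[OF mem(2)]]
        has_integral_mult_right[OF int[OF mem(3)], where c = 2]]
    by (simp add: diff_divide_distrib add_divide_distrib)
  note int_diff = integral_unique[OF this]
  define I where "I = integral {0..t} (\<lambda>\<eta>. (wt (x + r) \<eta> + wt (x - r) \<eta> - 2 * wt x \<eta>) / ?K \<eta>)"
  have "\<bar>I\<bar> \<le> 2 * B * r^2 * (((t - 0) powr (1 - \<alpha>) - (t - t) powr (1 - \<alpha>)) / (1 - \<alpha>))"
    unfolding I_def
  proof (rule abs_integral_kernel_le)
    show "continuous_on {0..t} (\<lambda>\<eta>. wt (x + r) \<eta> + wt (x - r) \<eta> - 2 * wt x \<eta>)"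
      by (intro continuous_intros cont_t mem)
    fix \<eta> assume "\<eta> \<in> {0..t}"
    then have \<eta>: "\<eta> \<in> {0..T}" using t by simp
    show "\<bar>wt (x + r) \<eta> + wt (x - r) \<eta> - 2 * wt x \<eta>\<bar> \<le> 2 * B * r^2"
      by (rule second_difference_le[of a b "\<lambda>y. wt y \<eta>" "\<lambda>y. wtx y \<eta>" "\<lambda>y. wtxx y \<eta>",
        OF wtx[OF _ \<eta>] wtxx[OF _ \<eta>] B[OF _ \<eta>] r])
  qed (use \<alpha> t in auto)
  moreover have "2 * B * r^2 * (((t - 0) powr (1 - \<alpha>) - (t - t) powr (1 - \<alpha>)) / (1 - \<alpha>))
      \<le> 2 * B * r^2 * (T powr (1 - \<alpha>) / (1 - \<alpha>))"
  proof (intro mult_left_mono divide_right_mono)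
    have "t powr (1 - \<alpha>) \<le> T powr (1 - \<alpha>)"
      using t \<alpha> by (intro powr_mono2) auto
    then show "(t - 0) powr (1 - \<alpha>) - (t - t) powr (1 - \<alpha>) \<le> T powr (1 - \<alpha>)" by simp
    show "0 \<le> 2 * B * r\<^sup>2"
      using B[OF mem(3), of 0] t by simp
  qed (use \<alpha> in simp)
  ultimately have I_le: "\<bar>I\<bar> \<le> 2 * B * r^2 * (T powr (1 - \<alpha>) / (1 - \<alpha>))"
    by (rule order_trans)
  have Gpos: "0 < Gamma (1 - \<alpha>)"
    using \<alpha> by (intro Gamma_real_pos) simp
  have eq: "caputo \<alpha> (w (x + r)) t + caputo \<alpha> (w (x - r)) t - 2 * caputo \<alpha> (w x) t = I / Gamma (1 - \<alpha>)"
    unfolding cap[OF mem(1)] cap[OF mem(2)] cap[OF mem(3)] I_def int_diff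
    by (simp add: diff_divide_distrib add_divide_distrib)
  show ?thesis
    unfolding eq using divide_right_mono[OF I_le less_imp_le[OF Gpos]] Gpos by simp
qed

section \<open>Consistency of the two numerical fluxes\<close>

lemma grid_points:
  fixes a b :: real and N i :: nat
  assumes "a < b"
  defines "h \<equiv> space_step a b N"
  shows "0 < h" "real N * h \<le> b - a" "h \<le> b - a"
    and "i \<le> N + 1 \<Longrightarrow> node a h i \<in> {a..b}"
proof -
  have eq: "(real N + 1) * h = b - a"
    by (simp add: h_def space_step_def)
  show h: "0 < h"
    using assms by (simp add: h_def space_step_def)
  have le: "c * h \<le> (real N + 1) * h" if "c \<le> real N + 1" for c
    using h that by (intro mult_right_mono) auto
  show "real N * h \<le> b - a" "h \<le> b - a"
    using eq le[of "real N"] le[of 1] by auto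
  show "node a h i \<in> {a..b}" if "i \<le> N + 1"
    using eq le[of "real i"] h that by (auto simp: node_def)
qed

text \<open>Up to the factor \<open>1 / h\<close>, the difference of the flux errors is the error of
  the central difference of \<open>d v\<close> about \<open>x - h / 2\<close> with half step
  \<open>h / 2\<close>. The second differences of \<open>d v1\<close> are governed by
  \<open>d v3\<close>, which is at most \<open>B * h\<close>; this yields \<open>B * h^4 / 4\<close>
  before the division by \<open>h\<close>.\<close>

lemma diffusive_flux_consistency:
  fixes v :: "real \<Rightarrow> real"
  assumes v: "\<And>x. x \<in> {a..b} \<Longrightarrow> (v has_real_derivative v1 x) (at x within {a..b})"
    "\<And>x. x \<in> {a..b} \<Longrightarrow> (v1 has_real_derivative v2 x) (at x within {a..b})"
    "\<And>x. x \<in> {a..b} \<Longrightarrow> (v2 has_real_derivative v3 x) (at x within {a..b})"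
    "\<And>x. x \<in> {a..b} \<Longrightarrow> (v3 has_real_derivative v4 x) (at x within {a..b})"
    and B: "\<And>x. x \<in> {a..b} \<Longrightarrow> \<bar>v4 x\<bar> \<le> B"
    and h: "0 < h" "a \<le> x - h" "x + h \<le> b"
  shows "\<bar>((v (x + h) - v x) / h - v1 (x + h / 2)) - ((v x - v (x - h)) / h - v1 (x - h / 2))\<bar> \<le> B / 4 * h^3"
proof -
  define d where "d g x = g (x + h) - g x" for g :: "real \<Rightarrow> real" and x
  note d_der = has_real_derivative_forward_difference[OF _ less_imp_le[OF h(1)], folded d_def]
  have B_nonneg: "0 \<le> B" using B[of x] h by auto
  have "\<bar>d v (x - h / 2 + h / 2) - d v (x - h / 2 - h / 2) - 2 * (h / 2) * d v1 (x - h / 2)\<bar>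
      \<le> 2 * (B * h) * (h / 2)^2 * (h / 2)"
  proof (rule central_difference_le[OF d_der[OF v(1)]])
    fix r assume r: "0 \<le> r" "r \<le> h / 2"
    have "\<bar>d v1 (x - h / 2 + r) + d v1 (x - h / 2 - r) - 2 * d v1 (x - h / 2)\<bar> \<le> 2 * (B * h) * r^2"
    proof (rule second_difference_le[OF d_der[OF v(2)] d_der[OF v(3)]])
      fix y assume "y \<in> {a..b - h}"
      then show "\<bar>d v3 y\<bar> \<le> B * h"
        unfolding d_def using h by (intro abs_forward_difference_le[OF v(4) B]) auto
    qed (use r h in auto)
    also have "\<dots> \<le> 2 * (B * h) * (h / 2)^2"
      using r B_nonneg h by (intro mult_left_mono power_mono) auto
    finally show "\<bar>d v1 (x - h / 2 + r) + d v1 (x - h / 2 - r) - 2 * d v1 (x - h / 2)\<bar>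
        \<le> 2 * (B * h) * (h / 2)^2" .
  qed (use h in auto)
  then have *: "\<bar>d v x - d v (x - h) - h * d v1 (x - h / 2)\<bar> \<le> B * h^4 / 4"
    by (simp add: power2_eq_square power4_eq_xxxx mult_ac)
  have mid: "x - h / 2 + h = x + h / 2" by simp
  have "((v (x + h) - v x) / h - v1 (x + h / 2)) - ((v x - v (x - h)) / h - v1 (x - h / 2))
      = (d v x - d v (x - h) - h * d v1 (x - h / 2)) / h"
    unfolding d_def mid using h by (simp add: field_simps)
  also have "\<bar>\<dots>\<bar> = \<bar>d v x - d v (x - h) - h * d v1 (x - h / 2)\<bar> / h"
    using h by simp
  also have "\<dots> \<le> (B * h^4 / 4) / h"
    using * h by (intro divide_right_mono) auto
  also have "\<dots> = B / 4 * h^3"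
    using h by (simp add: power4_eq_xxxx power3_eq_cube)
  finally show ?thesis .
qed

lemma abs_halves_le:
  fixes p q z :: real
  assumes "\<bar>p\<bar> \<le> z / 2" "q = p / 2"
  shows "\<bar>q\<bar> \<le> z / 4"
  using assms by simp

text \<open>The error of the average is half a second difference with step \<open>h / 2\<close>. For
  the difference of two such errors the same argument is applied to \<open>d v\<close>, whose second
  derivative \<open>d v2\<close> is at most \<open>B * h\<close>.\<close>

lemma midpoint_average_consistency:
  fixes v :: "real \<Rightarrow> real"
  assumes v: "\<And>x. x \<in> {a..b} \<Longrightarrow> (v has_real_derivative v1 x) (at x within {a..b})"
    "\<And>x. x \<in> {a..b} \<Longrightarrow> (v1 has_real_derivative v2 x) (at x within {a..b})"
    "\<And>x. x \<in> {a..b} \<Longrightarrow> (v2 has_real_derivative v3 x) (at x within {a..b})"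
    and B: "\<And>x. x \<in> {a..b} \<Longrightarrow> \<bar>v2 x\<bar> \<le> B" "\<And>x. x \<in> {a..b} \<Longrightarrow> \<bar>v3 x\<bar> \<le> B"
    and h: "0 < h" "a \<le> x - h" "x + h \<le> b"
  shows "\<bar>(v (x - h) + v x) / 2 - v (x - h / 2)\<bar> \<le> B / 4 * h^2" (is ?t1)
    and "\<bar>((v x + v (x + h)) / 2 - v (x + h / 2)) - ((v (x - h) + v x) / 2 - v (x - h / 2))\<bar>
      \<le> B / 4 * h^3" (is ?t2)
proof -
  have "\<bar>v (x - h / 2 + h / 2) + v (x - h / 2 - h / 2) - 2 * v (x - h / 2)\<bar> \<le> 2 * B * (h / 2)^2"
    using h by (intro second_difference_le[OF v(1,2) B(1)]) auto
  then have "\<bar>v x + v (x - h) - 2 * v (x - h / 2)\<bar> \<le> (B * h^2) / 2"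
    by (simp add: power2_eq_square)
  then have "\<bar>(v (x - h) + v x) / 2 - v (x - h / 2)\<bar> \<le> (B * h^2) / 4"
    by (rule abs_halves_le) (simp add: field_simps)
  then show ?t1 by simp
  define d where "d g x = g (x + h) - g x" for g :: "real \<Rightarrow> real" and x
  note d_der = has_real_derivative_forward_difference[OF _ less_imp_le[OF h(1)], folded d_def]
  have "\<bar>d v (x - h / 2 + h / 2) + d v (x - h / 2 - h / 2) - 2 * d v (x - h / 2)\<bar> \<le> 2 * (B * h) * (h / 2)^2"
  proof (rule second_difference_le[OF d_der[OF v(1)] d_der[OF v(2)]])
    fix y assume "y \<in> {a..b - h}"
    then show "\<bar>d v2 y\<bar> \<le> B * h"
      unfolding d_def using h by (intro abs_forward_difference_le[OF v(3) B(2)]) auto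
  qed (use h in auto)
  then have "\<bar>d v x + d v (x - h) - 2 * d v (x - h / 2)\<bar> \<le> B / 2 * h^3"
    by (simp add: power2_eq_square power3_eq_cube mult_ac)
  moreover have "x - h / 2 + h = x + h / 2" by simp
  ultimately have "\<bar>v (x + h) - v x + (v x - v (x - h)) - 2 * (v (x + h / 2) - v (x - h / 2))\<bar> \<le> (B * h^3) / 2"
    by (simp add: d_def)
  then have "\<bar>((v x + v (x + h)) / 2 - v (x + h / 2)) - ((v (x - h) + v x) / 2 - v (x - h / 2))\<bar>
      \<le> (B * h^3) / 4"
    by (rule abs_halves_le) (simp add: field_simps)
  then show ?t2 by simp
qed

lemma abs_f_parts_le:
  fixes f :: "real \<Rightarrow> real"
  assumes "0 < \<kappa>" "0 < h" "\<bar>f y\<bar> \<le> F"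
  shows "\<bar>f_upper \<kappa> h f y\<bar> \<le> F" "\<bar>f_lower \<kappa> h f y\<bar> \<le> F" "\<bar>f_middle \<kappa> h f y\<bar> \<le> F"
proof -
  have "0 < 2 * \<kappa> / h" using assms by simp
  then show "\<bar>f_upper \<kappa> h f y\<bar> \<le> F" "\<bar>f_lower \<kappa> h f y\<bar> \<le> F" "\<bar>f_middle \<kappa> h f y\<bar> \<le> F"
    using assms(3) unfolding f_upper_def f_lower_def f_middle_def by linarith+
qed

lemma f_parts_fine_grid:
  fixes f :: "real \<Rightarrow> real"
  assumes "0 < h" "\<bar>f y\<bar> \<le> F" "h * F \<le> 2 * \<kappa>"
  shows "f_upper \<kappa> h f y = 0" "f_lower \<kappa> h f y = 0" "f_middle \<kappa> h f y = f y"
proof -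
  have "F \<le> 2 * \<kappa> / h" using assms by (simp add: field_simps)
  then show "f_upper \<kappa> h f y = 0" "f_lower \<kappa> h f y = 0" "f_middle \<kappa> h f y = f y"
    using assms(2) unfolding f_upper_def f_lower_def f_middle_def by linarith+
qed

text \<open>On grids with \<open>h * F > 2 * \<kappa>\<close> the upwind terms are present, but then \<open>h\<close> is bounded below and
  a mere bound on the fluxes is of order \<open>h\<^sup>3\<close>, so that no case distinction is
  needed in the final estimate.\<close>

lemma advective_flux_consistency:
  fixes v :: "real \<Rightarrow> real"
  assumes v: "\<And>x. x \<in> {a..b} \<Longrightarrow> (v has_real_derivative v1 x) (at x within {a..b})"
    "\<And>x. x \<in> {a..b} \<Longrightarrow> (v1 has_real_derivative v2 x) (at x within {a..b})"
    "\<And>x. x \<in> {a..b} \<Longrightarrow> (v2 has_real_derivative v3 x) (at x within {a..b})"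
    and B: "\<And>x. x \<in> {a..b} \<Longrightarrow> \<bar>v x\<bar> \<le> B" "\<And>x. x \<in> {a..b} \<Longrightarrow> \<bar>v2 x\<bar> \<le> B"
      "\<And>x. x \<in> {a..b} \<Longrightarrow> \<bar>v3 x\<bar> \<le> B"
    and h: "0 < h" "a \<le> x - h" "x + h \<le> b" and "0 < \<kappa>" "0 \<le> M"
    and F: "\<And>x. x \<in> {a..b} \<Longrightarrow> \<bar>f x\<bar> \<le> F"
    and lip: "\<And>x y. x \<in> {a..b} \<Longrightarrow> y \<in> {a..b} \<Longrightarrow> \<bar>f x - f y\<bar> \<le> M * \<bar>x - y\<bar>"
  defines "A \<equiv> \<lambda>y l r. f_middle \<kappa> h f y * ((l + r) / 2) + f_upper \<kappa> h f y * l + f_lower \<kappa> h f y * r"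
  shows "\<bar>(A (x + h / 2) (v x) (v (x + h)) - f (x + h / 2) * v (x + h / 2))
      - (A (x - h / 2) (v (x - h)) (v x) - f (x - h / 2) * v (x - h / 2))\<bar>
    \<le> ((F + M) * (B / 4) + F^4 * B / \<kappa>^3) * h^3"
proof -
  have mem: "x \<in> {a..b}" "x + h \<in> {a..b}" "x - h \<in> {a..b}" "x + h / 2 \<in> {a..b}" "x - h / 2 \<in> {a..b}"
    using h by auto
  have nonneg: "0 \<le> F" "0 \<le> B"
    using F[OF mem(1)] B(1)[OF mem(1)] by auto
  show ?thesis
  proof (cases "h * F \<le> 2 * \<kappa>")
    case True
    define E1 E0 where "E1 = (v x + v (x + h)) / 2 - v (x + h / 2)"
      and "E0 = (v (x - h) + v x) / 2 - v (x - h / 2)"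
    have A: "A y l r = f y * ((l + r) / 2)" if "y \<in> {a..b}" for y l r
      using f_parts_fine_grid[of h f y F \<kappa>, OF h(1) F[OF that] True] by (simp add: A_def)
    \<comment> \<open>Discrete product rule: the first term gets its order from the difference of
      the averaging errors, the second from the Lipschitz bound of \<open>f\<close> times one
      averaging error.\<close>
    have eq: "(A (x + h / 2) (v x) (v (x + h)) - f (x + h / 2) * v (x + h / 2))
        - (A (x - h / 2) (v (x - h)) (v x) - f (x - h / 2) * v (x - h / 2))
        = f (x + h / 2) * (E1 - E0) + (f (x + h / 2) - f (x - h / 2)) * E0"
      unfolding A[OF mem(4)] A[OF mem(5)] E1_def E0_def by (simp only: algebra_simps)
    have "\<bar>f (x + h / 2) * (E1 - E0) + (f (x + h / 2) - f (x - h / 2)) * E0\<bar>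
        \<le> \<bar>f (x + h / 2)\<bar> * \<bar>E1 - E0\<bar> + \<bar>f (x + h / 2) - f (x - h / 2)\<bar> * \<bar>E0\<bar>"
      unfolding abs_mult[symmetric] by (rule abs_triangle_ineq)
    also have "\<dots> \<le> F * (B / 4 * h^3) + (M * h) * (B / 4 * h^2)"
    proof (intro add_mono mult_mono)
      show "\<bar>E1 - E0\<bar> \<le> B / 4 * h^3" "\<bar>E0\<bar> \<le> B / 4 * h^2"
        unfolding E1_def E0_def by (rule midpoint_average_consistency[OF v B(2,3) h]; assumption)+
      show "\<bar>f (x + h / 2) - f (x - h / 2)\<bar> \<le> M * h"
        using lip[OF mem(4,5)] h by simp
    qed (use F[OF mem(4)] nonneg \<open>0 \<le> M\<close> h in auto)
    also have "\<dots> = (F + M) * (B / 4) * h^3"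
      by (simp add: power2_eq_square power3_eq_cube algebra_simps)
    also have "\<dots> \<le> ((F + M) * (B / 4) + F^4 * B / \<kappa>^3) * h^3"
      using nonneg h \<open>0 < \<kappa>\<close> by (intro mult_right_mono) auto
    finally show ?thesis unfolding eq .
  next
    case False
    have A: "\<bar>A y l r - f y * v y\<bar> \<le> 4 * (F * B)"
      if "y \<in> {a..b}" "\<bar>l\<bar> \<le> B" "\<bar>r\<bar> \<le> B" for y l r
    proof -
      note parts = abs_f_parts_le[of \<kappa> h f y F, OF \<open>0 < \<kappa>\<close> h(1) F[OF that(1)]]
      have prod: "\<bar>p * z\<bar> \<le> F * B" if "\<bar>p\<bar> \<le> F" "\<bar>z\<bar> \<le> B" for p z
        unfolding abs_mult using that nonneg by (intro mult_mono) auto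
      have "\<bar>(l + r) / 2\<bar> \<le> B" using abs_triangle_ineq[of l r] that(2,3) by simp
      note prod[OF parts(3) this] prod[OF parts(1) that(2)] prod[OF parts(2) that(3)]
        prod[OF F[OF that(1)] B(1)[OF that(1)]]
      then show ?thesis
        unfolding A_def by linarith
    qed
    have "1 \<le> h * F / (2 * \<kappa>)"
      using False \<open>0 < \<kappa>\<close> by simp
    then have "1 \<le> (h * F / (2 * \<kappa>))^3"
      by (rule one_le_power)
    \<comment> \<open>Each of the two faces contributes at most \<open>4 * (F * B)\<close>, from
      three flux terms and the exact flux. The cube of \<open>h * F / (2 * \<kappa>)\<close> is at
      least 1 and its denominator cancels the 8.\<close>
    then have "8 * (F * B) * 1 \<le> 8 * (F * B) * (h * F / (2 * \<kappa>))^3"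
      using nonneg by (intro mult_left_mono) auto
    also have "\<dots> = F^4 * B / \<kappa>^3 * h^3"
      using \<open>0 < \<kappa>\<close> by (simp add: power_divide power_mult_distrib power4_eq_xxxx power3_eq_cube field_simps)
    also have "\<dots> \<le> ((F + M) * (B / 4) + F^4 * B / \<kappa>^3) * h^3"
      using nonneg h \<open>0 \<le> M\<close> by (intro mult_right_mono) auto
    finally show ?thesis
      using A[OF mem(4) B(1)[OF mem(1)] B(1)[OF mem(2)]] A[OF mem(5) B(1)[OF mem(3)] B(1)[OF mem(1)]]
      by linarith
  qed
qed

section \<open>Functions of class C^m on the space-time rectangle\<close>

lemma C_on_imp_continuous_on:
  assumes "C_on m S u"
  shows "continuous_on S u"
proof (cases m)
  case 0
  then show ?thesis using assms by simp
next
  case (Suc k)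
  then have "C_on (Suc k) S u" using assms by simp
  then obtain D where "\<forall>z\<in>S. (u has_derivative D z) (at z within S)"
    unfolding C_on.simps by blast
  then show ?thesis
    unfolding continuous_on_eq_continuous_within using has_derivative_continuous by blast
qed

lemma C_on_imp_bounded:
  fixes u :: "real \<Rightarrow> real \<Rightarrow> real"
  assumes "C_on m ({a..b} \<times> {0..T}) (\<lambda>(x, t). u x t)"
  shows "\<exists>B. \<forall>x\<in>{a..b}. \<forall>t\<in>{0..T}. \<bar>u x t\<bar> \<le> B"
proof -
  have "bounded ((\<lambda>(x, t). u x t) ` ({a..b} \<times> {0..T}))"
    using assms by (intro compact_imp_bounded compact_continuous_image C_on_imp_continuous_on
      compact_Times compact_Icc) auto
  then obtain B where "\<forall>y\<in>(\<lambda>(x, t). u x t) ` ({a..b} \<times> {0..T}). norm y \<le> B"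
    unfolding bounded_iff by blast
  then show ?thesis
    by (intro exI[of _ B]) auto
qed

text \<open>The partial derivatives are the total derivative evaluated at the fixed vectors
  \<open>(1, 0)\<close> and \<open>(0, 1)\<close>. \<open>C_on\<close> requires class
  \<open>m\<close> for each fixed direction, so they inherit it; restriction to horizontal and
  vertical slices gives the one-variable derivatives, one-sided at the ends.\<close>

lemma C_on_partial_derivatives:
  fixes u :: "real \<Rightarrow> real \<Rightarrow> real"
  assumes "C_on (Suc m) ({a..b} \<times> {0..T}) (\<lambda>(x, t). u x t)"
  obtains ux ut where
    "C_on m ({a..b} \<times> {0..T}) (\<lambda>(x, t). ux x t)"
    "C_on m ({a..b} \<times> {0..T}) (\<lambda>(x, t). ut x t)"
    "\<And>x t. x \<in> {a..b} \<Longrightarrow> t \<in> {0..T} \<Longrightarrow> ((\<lambda>y. u y t) has_real_derivative ux x t) (at x within {a..b})"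
    "\<And>x t. x \<in> {a..b} \<Longrightarrow> t \<in> {0..T} \<Longrightarrow> (u x has_real_derivative ut x t) (at t within {0..T})"
proof -
  let ?R = "{a..b} \<times> {0..T}"
  have "\<exists>D. (\<forall>z\<in>?R. ((\<lambda>(x, t). u x t) has_derivative D z) (at z within ?R)) \<and>
      (\<forall>v. C_on m ?R (\<lambda>z. D z v))"
    using assms by (simp only: C_on.simps)
  then obtain D where D0:
    "(\<forall>z\<in>?R. ((\<lambda>(x, t). u x t) has_derivative D z) (at z within ?R)) \<and> (\<forall>v. C_on m ?R (\<lambda>z. D z v))" ..
  note D = bspec[OF conjunct1[OF D0]] spec[OF conjunct2[OF D0]]
  have lin: "D z (c *\<^sub>R v) = D z v * c" if "z \<in> ?R" for z c v
    using linear_scale[OF has_derivative_linear[OF D(1)[OF that]], of c v] by simp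
  show thesis
  proof (rule that[of "\<lambda>x t. D (x, t) (1, 0)" "\<lambda>x t. D (x, t) (0, 1)"])
    show "C_on m ?R (\<lambda>(x, t). D (x, t) (1, 0))" "C_on m ?R (\<lambda>(x, t). D (x, t) (0, 1))"
      unfolding case_prod_unfold prod.collapse by (rule D(2))+
    fix x t assume xt: "x \<in> {a..b}" "t \<in> {0..T}"
    then have R: "(x, t) \<in> ?R" by simp
    have 1: "((\<lambda>y. (y, t)) has_derivative (\<lambda>y. (y, 0))) (at x within {a..b})"
      by (intro has_derivative_Pair has_derivative_ident has_derivative_const)
    have 2: "((\<lambda>(x, t). u x t) has_derivative D (x, t)) (at (x, t) within (\<lambda>y. (y, t)) ` {a..b})"
      using xt by (intro has_derivative_subset[OF D(1)[OF R]]) auto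
    have "((\<lambda>y. u y t) has_derivative (\<lambda>y. D (x, t) (y, 0))) (at x within {a..b})"
      using diff_chain_within[OF 1 2] by (simp add: o_def)
    moreover have "(\<lambda>y. D (x, t) (y, 0)) = (*) (D (x, t) (1, 0))"
    proof
      show "D (x, t) (y, 0) = D (x, t) (1, 0) * y" for y
        using lin[OF R, of y "(1, 0)"] by simp
    qed
    ultimately show "((\<lambda>y. u y t) has_real_derivative D (x, t) (1, 0)) (at x within {a..b})"
      unfolding has_field_derivative_def by (simp only:)
    have 1: "((\<lambda>s. (x, s)) has_derivative (\<lambda>s. (0, s))) (at t within {0..T})"
      by (intro has_derivative_Pair has_derivative_ident has_derivative_const)
    have 2: "((\<lambda>(x, t). u x t) has_derivative D (x, t)) (at (x, t) within (\<lambda>s. (x, s)) ` {0..T})"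
      using xt by (intro has_derivative_subset[OF D(1)[OF R]]) auto
    have "(u x has_derivative (\<lambda>s. D (x, t) (0, s))) (at t within {0..T})"
      using diff_chain_within[OF 1 2] by (simp add: o_def)
    moreover have "(\<lambda>s. D (x, t) (0, s)) = (*) (D (x, t) (0, 1))"
    proof
      show "D (x, t) (0, s) = D (x, t) (0, 1) * s" for s
        using lin[OF R, of s "(0, 1)"] by simp
    qed
    ultimately show "(u x has_real_derivative D (x, t) (0, 1)) (at t within {0..T})"
      unfolding has_field_derivative_def by (simp only:)
  qed
qed

section \<open>Convergence\<close>

text \<open>The residual splits into the error of the L1 formula, the two flux errors and the error
  of replacing the mean of the Caputo derivative over a cell by its value at the centre. The last
  three are of order \<open>h^3\<close> and the first carries the cell width
  \<open>h\<close>.\<close>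

lemma fv_truncation_error:
  fixes w :: "real \<Rightarrow> real \<Rightarrow> real"
  assumes par: "a < b" "0 < T" "0 < \<alpha>" "\<alpha> < 1" "0 < \<kappa>"
    and lip: "M-lipschitz_on {a..b} f"
    and sol: "ibvp_solution a b T \<alpha> \<kappa> f \<phi> g1 g2 w"
    and smooth: "C_on (Suc (Suc (Suc (Suc 0)))) ({a..b} \<times> {0..T}) (\<lambda>(x, t). w x t)"
  obtains K where "0 \<le> K"
    "\<And>N L i n. i \<in> {1..N} \<Longrightarrow> n \<in> {1..L} \<Longrightarrow>
      \<bar>scheme_residual a \<alpha> \<kappa> (space_step a b N) (time_step T L) f
        (\<lambda>i n. w (node a (space_step a b N) i) (time_node (time_step T L) n)) i n\<bar>
      \<le> space_step a b N * (K * (time_step T L powr (2 - \<alpha>) + (space_step a b N)^2))"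
proof -
  obtain w1 wt where
    w1: "C_on (Suc (Suc (Suc 0))) ({a..b} \<times> {0..T}) (\<lambda>(x, t). w1 x t)" and wt: "C_on (Suc (Suc (Suc 0))) ({a..b} \<times> {0..T}) (\<lambda>(x, t). wt x t)" and
    w1': "\<And>x t. x \<in> {a..b} \<Longrightarrow> t \<in> {0..T} \<Longrightarrow> ((\<lambda>y. w y t) has_real_derivative w1 x t) (at x within {a..b})" and
    wt': "\<And>x t. x \<in> {a..b} \<Longrightarrow> t \<in> {0..T} \<Longrightarrow> (w x has_real_derivative wt x t) (at t within {0..T})"
    using C_on_partial_derivatives[OF smooth] by blast
  obtain w2 w1t where
    w2: "C_on (Suc (Suc 0)) ({a..b} \<times> {0..T}) (\<lambda>(x, t). w2 x t)" and w1t: "C_on (Suc (Suc 0)) ({a..b} \<times> {0..T}) (\<lambda>(x, t). w1t x t)" and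
    w2': "\<And>x t. x \<in> {a..b} \<Longrightarrow> t \<in> {0..T} \<Longrightarrow> ((\<lambda>y. w1 y t) has_real_derivative w2 x t) (at x within {a..b})" and
    w1t': "\<And>x t. x \<in> {a..b} \<Longrightarrow> t \<in> {0..T} \<Longrightarrow> (w1 x has_real_derivative w1t x t) (at t within {0..T})"
    using C_on_partial_derivatives[OF w1] by blast
  obtain w3 w2t where
    w3: "C_on (Suc 0) ({a..b} \<times> {0..T}) (\<lambda>(x, t). w3 x t)" and w2t: "C_on (Suc 0) ({a..b} \<times> {0..T}) (\<lambda>(x, t). w2t x t)" and
    w3': "\<And>x t. x \<in> {a..b} \<Longrightarrow> t \<in> {0..T} \<Longrightarrow> ((\<lambda>y. w2 y t) has_real_derivative w3 x t) (at x within {a..b})" and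
    w2t': "\<And>x t. x \<in> {a..b} \<Longrightarrow> t \<in> {0..T} \<Longrightarrow> (w2 x has_real_derivative w2t x t) (at t within {0..T})"
    using C_on_partial_derivatives[OF w2] by blast
  obtain w4 w3t where
    w4: "C_on (0) ({a..b} \<times> {0..T}) (\<lambda>(x, t). w4 x t)" and w3t: "C_on (0) ({a..b} \<times> {0..T}) (\<lambda>(x, t). w3t x t)" and
    w4': "\<And>x t. x \<in> {a..b} \<Longrightarrow> t \<in> {0..T} \<Longrightarrow> ((\<lambda>y. w3 y t) has_real_derivative w4 x t) (at x within {a..b})" and
    w3t': "\<And>x t. x \<in> {a..b} \<Longrightarrow> t \<in> {0..T} \<Longrightarrow> (w3 x has_real_derivative w3t x t) (at t within {0..T})"
    using C_on_partial_derivatives[OF w3] by blast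
  obtain wtx wtt where
    wtx: "C_on (Suc (Suc 0)) ({a..b} \<times> {0..T}) (\<lambda>(x, t). wtx x t)" and wtt: "C_on (Suc (Suc 0)) ({a..b} \<times> {0..T}) (\<lambda>(x, t). wtt x t)" and
    wtx': "\<And>x t. x \<in> {a..b} \<Longrightarrow> t \<in> {0..T} \<Longrightarrow> ((\<lambda>y. wt y t) has_real_derivative wtx x t) (at x within {a..b})" and
    wtt': "\<And>x t. x \<in> {a..b} \<Longrightarrow> t \<in> {0..T} \<Longrightarrow> (wt x has_real_derivative wtt x t) (at t within {0..T})"
    using C_on_partial_derivatives[OF wt] by blast
  obtain wtxx wtxt where
    wtxx: "C_on (Suc 0) ({a..b} \<times> {0..T}) (\<lambda>(x, t). wtxx x t)" and wtxt: "C_on (Suc 0) ({a..b} \<times> {0..T}) (\<lambda>(x, t). wtxt x t)" and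
    wtxx': "\<And>x t. x \<in> {a..b} \<Longrightarrow> t \<in> {0..T} \<Longrightarrow> ((\<lambda>y. wtx y t) has_real_derivative wtxx x t) (at x within {a..b})" and
    wtxt': "\<And>x t. x \<in> {a..b} \<Longrightarrow> t \<in> {0..T} \<Longrightarrow> (wtx x has_real_derivative wtxt x t) (at t within {0..T})"
    using C_on_partial_derivatives[OF wtx] by blast
  \<comment> \<open>These are the functions whose bounds enter the estimates. The highest order is
    four, attained by \<open>w4\<close>; \<open>wtxx\<close> serves the second differences of the
    Caputo derivative and \<open>wtt\<close> the Lipschitz bound of \<open>wt\<close> in
    time.\<close>
  let ?D = "{w, w2, w3, w4, wtt, wtxx}"
  have "\<exists>\<beta>. \<forall>u\<in>?D. \<forall>x\<in>{a..b}. \<forall>t\<in>{0..T}. \<bar>u x t\<bar> \<le> \<beta> u"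
  proof (rule bchoice)
    show "\<forall>u\<in>?D. \<exists>B. \<forall>x\<in>{a..b}. \<forall>t\<in>{0..T}. \<bar>u x t\<bar> \<le> B"
      unfolding ball_simps
      by (intro conjI TrueI C_on_imp_bounded[OF smooth] C_on_imp_bounded[OF w2] C_on_imp_bounded[OF w3]
        C_on_imp_bounded[OF w4] C_on_imp_bounded[OF wtt] C_on_imp_bounded[OF wtxx])
  qed
  then obtain \<beta> where \<beta>: "\<And>u x t. u \<in> ?D \<Longrightarrow> x \<in> {a..b} \<Longrightarrow> t \<in> {0..T} \<Longrightarrow> \<bar>u x t\<bar> \<le> \<beta> u"
    by blast
  define B where "B = Max (\<beta> ` ?D)"
  have \<beta>_le: "\<beta> u \<le> B" if "u \<in> ?D" for u
    unfolding B_def by (rule Max_ge) (use that in auto)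
  have D_le: "\<bar>u x t\<bar> \<le> B" if "u \<in> ?D" "x \<in> {a..b}" "t \<in> {0..T}" for u x t
    using order_trans[OF \<beta>[OF that] \<beta>_le[OF that(1)]] .
  have B: "\<And>x t. x \<in> {a..b} \<Longrightarrow> t \<in> {0..T} \<Longrightarrow> \<bar>w x t\<bar> \<le> B"
      "\<And>x t. x \<in> {a..b} \<Longrightarrow> t \<in> {0..T} \<Longrightarrow> \<bar>w2 x t\<bar> \<le> B"
      "\<And>x t. x \<in> {a..b} \<Longrightarrow> t \<in> {0..T} \<Longrightarrow> \<bar>w3 x t\<bar> \<le> B"
      "\<And>x t. x \<in> {a..b} \<Longrightarrow> t \<in> {0..T} \<Longrightarrow> \<bar>w4 x t\<bar> \<le> B"
      "\<And>x t. x \<in> {a..b} \<Longrightarrow> t \<in> {0..T} \<Longrightarrow> \<bar>wtt x t\<bar> \<le> B"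
      "\<And>x t. x \<in> {a..b} \<Longrightarrow> t \<in> {0..T} \<Longrightarrow> \<bar>wtxx x t\<bar> \<le> B"
    by (rule D_le; simp)+
  have B_nonneg: "0 \<le> B"
    using B(1)[of a 0] par by auto
  have M: "\<bar>f x - f y\<bar> \<le> M * \<bar>x - y\<bar>" if "x \<in> {a..b}" "y \<in> {a..b}" for x y
    using lip that by (auto simp: lipschitz_on_def dist_real_def)
  have "0 \<le> M" using lip by (rule lipschitz_on_nonneg)
  define F where "F = \<bar>f a\<bar> + M * (b - a)"
  have F: "\<bar>f x\<bar> \<le> F" if "x \<in> {a..b}" for x
  proof -
    have "\<bar>f x - f a\<bar> \<le> M * \<bar>x - a\<bar>" using M[OF that, of a] par by simp
    also have "\<dots> \<le> M * (b - a)" using \<open>0 \<le> M\<close> that by (intro mult_left_mono) auto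
    finally show ?thesis by (simp add: F_def)
  qed
  have "0 \<le> F" using \<open>0 \<le> M\<close> par by (simp add: F_def)
  obtain wx wxx q where eqn: "\<And>x t. x \<in> {a..b} \<Longrightarrow> t \<in> {0<..T} \<Longrightarrow>
      ((\<lambda>y. w y t) has_real_derivative wx x t) (at x within {a..b}) \<and>
      ((\<lambda>y. wx y t) has_real_derivative wxx x t) (at x within {a..b}) \<and>
      ((\<lambda>y. f y * w y t) has_real_derivative q x t) (at x within {a..b}) \<and>
      caputo \<alpha> (w x) t = \<kappa> * wxx x t - q x t"
    using sol unfolding ibvp_solution_def by blast
  \<comment> \<open>The derivative \<open>wx\<close> comes from the notion of solution,
    \<open>w1\<close> from smoothness. They coincide at interior points by uniqueness, and the cell
    faces \<open>x + h / 2\<close> and \<open>x - h / 2\<close> are interior.\<close>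
  have wx_eq: "wx x t = w1 x t" if "x \<in> {a<..<b}" "t \<in> {0<..T}" for x t
  proof (rule DERIV_unique)
    have "at x within {a..b} = at x"
      using that by (intro at_within_interior) auto
    then show "((\<lambda>y. w y t) has_real_derivative wx x t) (at x)"
      "((\<lambda>y. w y t) has_real_derivative w1 x t) (at x)"
      using eqn[of x t] w1'[of x t] that by auto
  qed
  define c where "c = T powr (1 - \<alpha>) / ((1 - \<alpha>) * Gamma (1 - \<alpha>))"
  define c' where "c' = (1 + 1 / (1 - \<alpha>)) / Gamma (1 - \<alpha>)"
  have "0 < Gamma (1 - \<alpha>)" using par by (intro Gamma_real_pos) auto
  then have c_nonneg: "0 \<le> c" "0 \<le> c'" using par by (auto simp: c_def c'_def)
  define KF where "KF = (F + M) * (B / 4) + F^4 * B / \<kappa>^3"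
  have KF: "0 \<le> KF" using \<open>0 \<le> F\<close> \<open>0 \<le> M\<close> B_nonneg par by (auto simp: KF_def)
  define K where "K = B * c' + (B * c / 4 + \<kappa> * (B / 4) + KF)"
  have K_ge: "B * c' \<le> K" "B * c / 4 + \<kappa> * (B / 4) + KF \<le> K"
    using c_nonneg KF B_nonneg par by (auto simp: K_def)
  show thesis
  proof
    show "0 \<le> K"
      using c_nonneg KF B_nonneg par by (auto simp: K_def)
    fix N L i n :: nat
    assume i: "i \<in> {1..N}" and n: "n \<in> {1..L}"
    define h \<tau> x t where "h = space_step a b N" and "\<tau> = time_step T L" and "x = node a h i"
      and "t = time_node \<tau> n"
    define V where "V i n = w (node a h i) (time_node \<tau> n)" for i n
    have "0 < \<tau>" using par n by (simp add: \<tau>_def time_step_def)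
    have "real n * \<tau> \<le> real L * \<tau>" using n \<open>0 < \<tau>\<close> by (intro mult_right_mono) auto
    also have "\<dots> = T" using n by (simp add: \<tau>_def time_step_def)
    finally have t: "0 < t" "t \<le> T" "t = real n * \<tau>"
      using \<open>0 < \<tau>\<close> n by (auto simp: t_def time_node_def)
    then have t_mem: "t \<in> {0..T}" "t \<in> {0<..T}" by auto
    have "0 < h" using par by (simp add: h_def grid_points)
    have nodes: "node a h (i + 1) = x + h" "node a h (i - 1) = x - h"
      "midpoint_node a h i = x + h / 2" "midpoint_node a h (i - 1) = x - h / 2"
      using i by (auto simp: node_def midpoint_node_def x_def of_nat_diff algebra_simps)
    have x: "a \<le> x - h" "x + h \<le> b"
      using grid_points(4)[OF par(1), of "i + 1" N] grid_points(4)[OF par(1), of "i - 1" N] i nodes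
      by (auto simp: h_def)
    then have x_mem: "x \<in> {a..b}" "x + h / 2 \<in> {a<..<b}" "x - h / 2 \<in> {a<..<b}"
      using \<open>0 < h\<close> by auto
    define \<psi> where "\<psi> y = caputo \<alpha> (w y) t" for y
    define L1 where "L1 = \<tau> powr (- \<alpha>) / Gamma (2 - \<alpha>) *
       (V i n - (\<Sum>k = 1..<n. (L1_coeff \<alpha> (n - k - 1) - L1_coeff \<alpha> (n - k)) * V i k)
        - L1_coeff \<alpha> (n - 1) * V i 0)"
    \<comment> \<open>\<open>G\<close> is the exact flux. By the differential equation its space
      derivative is the Caputo derivative \<open>\<psi>\<close>.\<close>
    define G where "G y = \<kappa> * wx y t - f y * w y t" for y
    define E1 where "E1 = ((w (x + h) t - w x t) / h - w1 (x + h / 2) t)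
      - ((w x t - w (x - h) t) / h - w1 (x - h / 2) t)"
    define A where "A y l r = f_middle \<kappa> h f y * ((l + r) / 2) + f_upper \<kappa> h f y * l + f_lower \<kappa> h f y * r" for y l r
    define E2 where "E2 = (A (x + h / 2) (w x t) (w (x + h) t) - f (x + h / 2) * w (x + h / 2) t)
      - (A (x - h / 2) (w (x - h) t) (w x t) - f (x - h / 2) * w (x - h / 2) t)"
    have time: "\<bar>\<psi> x - L1\<bar> \<le> B * \<tau> powr (2 - \<alpha>) * c'"
      unfolding \<psi>_def L1_def V_def c'_def x_def[symmetric] time_node_def t(3) of_nat_0 mult_zero_left
    proof (rule L1_formula_error[OF par(3,4) \<open>0 < \<tau>\<close>])
      show "1 \<le> n" "real n * \<tau> \<le> T" using n t by auto
      show "(w x has_real_derivative wt x s) (at s within {0..T})" if "s \<in> {0..T}" for s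
        using wt'[OF x_mem(1) that] .
      show "\<bar>wt x s - wt x r\<bar> \<le> B * \<bar>s - r\<bar>" if "s \<in> {0..T}" "r \<in> {0..T}" for s r
        using field_differentiable_bound[of "{0..T}" "wt x" "wtt x" B s r] wtt'[OF x_mem(1)] B(5)[OF x_mem(1)] that
        by simp
    qed
    have "\<bar>G (x + h / 2) - G (x - h / 2) - 2 * (h / 2) * \<psi> x\<bar> \<le> (2 * B * (h / 2)^2 * c) * (h / 2)"
    proof (rule central_difference_le)
      fix y assume "y \<in> {a..b}"
      from eqn[OF this t_mem(2)] show "(G has_real_derivative \<psi> y) (at y within {a..b})"
        unfolding G_def \<psi>_def by (auto intro!: DERIV_diff DERIV_cmult)
    next
      fix r assume r: "0 \<le> r" "r \<le> h / 2"
      have "\<bar>\<psi> (x + r) + \<psi> (x - r) - 2 * \<psi> x\<bar> \<le> 2 * B * r^2 * c"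
        unfolding \<psi>_def c_def
      proof (rule caputo_second_difference_le[OF par(3,4) _ t(2) wt' _ wtx' wtxx' B(6)])
        show "continuous_on {0..T} (wt y)" if "y \<in> {a..b}" for y
          using wtt'[OF that] by (rule DERIV_continuous_on)
      qed (use r x \<open>0 < h\<close> t in auto)
      also have "\<dots> \<le> 2 * B * (h / 2)^2 * c"
        using r c_nonneg B_nonneg by (intro mult_right_mono mult_left_mono power_mono) auto
      finally show "\<bar>\<psi> (x + r) + \<psi> (x - r) - 2 * \<psi> x\<bar> \<le> 2 * B * (h / 2)^2 * c" .
    qed (use x \<open>0 < h\<close> in auto)
    then have space: "\<bar>G (x + h / 2) - G (x - h / 2) - h * \<psi> x\<bar> \<le> B * c / 4 * h^3"
      by (simp add: power2_eq_square power3_eq_cube mult_ac)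
    have diffusive: "\<bar>E1\<bar> \<le> B / 4 * h^3"
      unfolding E1_def
      using w1' w2' w3' w4' B(4) t_mem(1) \<open>0 < h\<close> x
      by (intro diffusive_flux_consistency[of a b "\<lambda>y. w y t" "\<lambda>y. w1 y t" "\<lambda>y. w2 y t" "\<lambda>y. w3 y t" "\<lambda>y. w4 y t"]) auto
    have advective: "\<bar>E2\<bar> \<le> KF * h^3"
      unfolding E2_def A_def KF_def
      using w1' w2' w3' B(1-3) t_mem(1) \<open>0 < h\<close> x par(5) \<open>0 \<le> M\<close> F M
      by (intro advective_flux_consistency[of a b "\<lambda>y. w y t" "\<lambda>y. w1 y t" "\<lambda>y. w2 y t" "\<lambda>y. w3 y t"]) auto
    have V: "V i n = w x t" "V (i + 1) n = w (x + h) t" "V (i - 1) n = w (x - h) t"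
      unfolding V_def nodes by (simp_all add: x_def t_def)
    have i1: "i - 1 + 1 = i" using i by auto
    have adv: "advective_flux a \<kappa> h f V i n = A (x + h / 2) (w x t) (w (x + h) t)"
      "advective_flux a \<kappa> h f V (i - 1) n = A (x - h / 2) (w (x - h) t) (w x t)"
      unfolding advective_flux_def A_def nodes i1 V by simp_all
    have diff: "diffusive_flux h V i n = (w (x + h) t - w x t) / h"
      "diffusive_flux h V (i - 1) n = (w x t - w (x - h) t) / h"
      unfolding diffusive_flux_def i1 V by simp_all
    have "scheme_residual a \<alpha> \<kappa> h \<tau> f V i n =
        h * L1 - (\<kappa> * (diffusive_flux h V i n - diffusive_flux h V (i - 1) n)
       - (advective_flux a \<kappa> h f V i n - advective_flux a \<kappa> h f V (i - 1) n))"
      by (simp add: scheme_residual_def L1_def)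
    \<comment> \<open>The term \<open>h * \<psi> x\<close> is inserted with both signs, and the
      exact fluxes subtracted in \<open>E1\<close> and \<open>E2\<close> recombine into the
      difference of \<open>G\<close>.\<close>
    also have "\<dots> = E2 - \<kappa> * E1 - h * (\<psi> x - L1) - (G (x + h / 2) - G (x - h / 2) - h * \<psi> x)"
      unfolding adv diff E1_def E2_def G_def wx_eq[OF x_mem(2) t_mem(2)] wx_eq[OF x_mem(3) t_mem(2)]
      by (simp only: algebra_simps)
    finally have "\<bar>scheme_residual a \<alpha> \<kappa> h \<tau> f V i n\<bar>
        \<le> \<bar>E2\<bar> + \<bar>\<kappa> * E1\<bar> + \<bar>h * (\<psi> x - L1)\<bar> + \<bar>G (x + h / 2) - G (x - h / 2) - h * \<psi> x\<bar>"
      by linarith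
    also have "\<dots> \<le> KF * h^3 + \<kappa> * (B / 4 * h^3) + h * (B * \<tau> powr (2 - \<alpha>) * c') + B * c / 4 * h^3"
      using par(5) \<open>0 < h\<close> diffusive time unfolding abs_mult
      by (intro add_mono advective space mult_mono) auto
    also have "\<dots> = h * ((B * c') * \<tau> powr (2 - \<alpha>) + (B * c / 4 + \<kappa> * (B / 4) + KF) * h^2)"
      by (simp add: power2_eq_square power3_eq_cube algebra_simps)
    also have "\<dots> \<le> h * (K * \<tau> powr (2 - \<alpha>) + K * h^2)"
      using \<open>0 < h\<close> by (intro mult_left_mono add_mono mult_right_mono K_ge) auto
    finally show "\<bar>scheme_residual a \<alpha> \<kappa> (space_step a b N) (time_step T L) f
        (\<lambda>i n. w (node a (space_step a b N) i) (time_node (time_step T L) n)) i n\<bar>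
      \<le> space_step a b N * (K * (time_step T L powr (2 - \<alpha>) + (space_step a b N)^2))"
      unfolding V_def h_def \<tau>_def by (simp add: distrib_left)
  qed
qed

text \<open>Stability is applied to the error with the truncation bound as source. The factor
  \<open>\<tau> powr \<alpha> / L1_coeff \<alpha> (n - 1)\<close> is at most
  \<open>(real n * \<tau>) powr \<alpha> / (1 - \<alpha>)\<close>, hence bounded through
  \<open>T\<close> alone. So the constant \<open>P\<close> is uniform in the level and the
  grid.\<close>

lemma fv_convergence:
  fixes w :: "real \<Rightarrow> real \<Rightarrow> real"
  assumes par: "a < b" "0 < T" "0 < \<alpha>" "\<alpha> < 1" "0 < \<kappa>"
    and lip: "M-lipschitz_on {a..b} f"
    and sol: "ibvp_solution a b T \<alpha> \<kappa> f \<phi> g1 g2 w"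
    and smooth: "C_on (Suc (Suc (Suc (Suc 0)))) ({a..b} \<times> {0..T}) (\<lambda>(x, t). w x t)"
  obtains P where "0 \<le> P"
    "\<And>N L W n. fv_solution a b T \<alpha> \<kappa> f g1 g2 N L W \<Longrightarrow> n \<in> {1..L} \<Longrightarrow>
      discrete_L1_norm (space_step a b N) N (grid_error a (space_step a b N) (time_step T L) w W n)
      \<le> discrete_L1_norm (space_step a b N) N (grid_error a (space_step a b N) (time_step T L) w W 0)
        + P * (time_step T L powr (2 - \<alpha>) + (space_step a b N)^2)"
proof -
  obtain K where K: "0 \<le> K"
    "\<And>N L i n. i \<in> {1..N} \<Longrightarrow> n \<in> {1..L} \<Longrightarrow>
      \<bar>scheme_residual a \<alpha> \<kappa> (space_step a b N) (time_step T L) f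
        (\<lambda>i n. w (node a (space_step a b N) i) (time_node (time_step T L) n)) i n\<bar>
      \<le> space_step a b N * (K * (time_step T L powr (2 - \<alpha>) + (space_step a b N)^2))"
    using fv_truncation_error[OF assms] by blast
  have Gpos: "0 < Gamma (1 - \<alpha>)" using par by (intro Gamma_real_pos) auto
  define P where "P = Gamma (1 - \<alpha>) * T powr \<alpha> * ((b - a) * K)"
  show thesis
  proof
    show "0 \<le> P" using Gpos K par by (simp add: P_def)
    fix N L n :: nat and W :: "nat \<Rightarrow> nat \<Rightarrow> real"
    assume W: "fv_solution a b T \<alpha> \<kappa> f g1 g2 N L W" and n: "n \<in> {1..L}"
    define h \<tau> where "h = space_step a b N" and "\<tau> = time_step T L"
    define \<rho> where "\<rho> = K * (\<tau> powr (2 - \<alpha>) + h^2)"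
    define e where "e i n = w (node a h i) (time_node \<tau> n) - W i n" for i n
    have "0 < h" "real N * h \<le> b - a" using par by (simp_all add: h_def grid_points)
    have "0 < \<tau>" using par n by (simp add: \<tau>_def time_step_def)
    have "0 \<le> \<rho>" using K by (simp add: \<rho>_def)
    have L\<tau>: "real L * \<tau> = T" using n by (simp add: \<tau>_def time_step_def)
    have "discrete_L1_norm h N (\<lambda>i. e i n) \<le> discrete_L1_norm h N (\<lambda>i. e i 0)
      + Gamma (2 - \<alpha>) * \<tau> powr \<alpha> * (real N * h * \<rho>) / L1_coeff \<alpha> (n - 1)"
    proof (rule fv_scheme_stability[OF par(3-5) \<open>0 < h\<close> \<open>0 < \<tau>\<close> \<open>0 \<le> \<rho>\<close> _ _ _ n])
      fix k assume k: "k \<in> {1..L}"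
      have "real k * \<tau> \<le> real L * \<tau>" using k \<open>0 < \<tau>\<close> by (intro mult_right_mono) auto
      then have "time_node \<tau> k \<in> {0<..T}"
        using k \<open>0 < \<tau>\<close> L\<tau> by (simp add: time_node_def)
      then have "w a (time_node \<tau> k) = g1 (time_node \<tau> k)" "w b (time_node \<tau> k) = g2 (time_node \<tau> k)"
        using sol by (auto simp: ibvp_solution_def)
      moreover have "W 0 k = g1 (time_node \<tau> k)" "W (N + 1) k = g2 (time_node \<tau> k)"
        using W k unfolding fv_solution_def Let_def \<tau>_def by auto
      moreover have "(real N + 1) * h = b - a"
        by (simp add: h_def space_step_def)
      then have "node a h 0 = a" "node a h (N + 1) = b"
        by (simp_all add: node_def algebra_simps)
      ultimately show "e 0 k = 0" "e (N + 1) k = 0" by (simp_all add: e_def)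
      fix i assume i: "i \<in> {1..N}"
      \<comment> \<open>By linearity the residual of \<open>e\<close> is then that of the exact
        solution, which the truncation estimate bounds.\<close>
      have "scheme_residual a \<alpha> \<kappa> h \<tau> f W i k = 0"
        using W i k by (simp add: fv_solution_def Let_def scheme_residual_def h_def \<tau>_def)
      then show "\<bar>scheme_residual a \<alpha> \<kappa> h \<tau> f e i k\<bar> \<le> h * \<rho>"
        using K(2)[OF i k] unfolding e_def scheme_residual_diff h_def \<tau>_def \<rho>_def by simp
    qed
    also have "Gamma (2 - \<alpha>) * \<tau> powr \<alpha> * (real N * h * \<rho>) / L1_coeff \<alpha> (n - 1)
      \<le> P * (\<tau> powr (2 - \<alpha>) + h^2)"
    proof -
      have G2: "Gamma (2 - \<alpha>) = (1 - \<alpha>) * Gamma (1 - \<alpha>)"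
        using Gamma_plus1[of "1 - \<alpha>"] nonpos_Ints_nonpos[of "1 - \<alpha>"] par by fastforce
      have "(1 - \<alpha>) * real n powr (- \<alpha>) \<le> L1_coeff \<alpha> (n - 1)"
        using L1_coeff_bounds(1)[OF par(3,4), of "n - 1"] n by (simp add: of_nat_diff)
      then have "Gamma (2 - \<alpha>) * \<tau> powr \<alpha> * (real N * h * \<rho>) / L1_coeff \<alpha> (n - 1)
        \<le> Gamma (2 - \<alpha>) * \<tau> powr \<alpha> * (real N * h * \<rho>) / ((1 - \<alpha>) * real n powr (- \<alpha>))"
        using par n \<open>0 < h\<close> \<open>0 \<le> \<rho>\<close> Gpos L1_coeff_pos[OF par(3,4)] unfolding G2
        by (intro divide_left_mono) auto
      also have "\<dots> = Gamma (1 - \<alpha>) * (real n * \<tau>) powr \<alpha> * (real N * h * \<rho>)"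
        using par n \<open>0 < \<tau>\<close> unfolding G2 by (simp add: powr_mult powr_minus_divide)
      also have "\<dots> \<le> Gamma (1 - \<alpha>) * T powr \<alpha> * ((b - a) * \<rho>)"
      proof (intro mult_mono powr_mono2)
        show "real n * \<tau> \<le> T"
          unfolding L\<tau>[symmetric] using n \<open>0 < \<tau>\<close> by (intro mult_right_mono) auto
      qed (use par Gpos \<open>0 < h\<close> \<open>0 < \<tau>\<close> \<open>0 \<le> \<rho>\<close> \<open>real N * h \<le> b - a\<close> in auto)
      finally show ?thesis by (simp add: P_def \<rho>_def mult_ac)
    qed
    finally show "discrete_L1_norm (space_step a b N) N (grid_error a (space_step a b N) (time_step T L) w W n)
      \<le> discrete_L1_norm (space_step a b N) N (grid_error a (space_step a b N) (time_step T L) w W 0)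
        + P * (time_step T L powr (2 - \<alpha>) + (space_step a b N)^2)"
      by (simp add: e_def grid_error_def[abs_def] h_def \<tau>_def)
  qed
qed

theorem theorem3p2:
  shows "\<exists>m::nat.
    \<forall>(a::real) (b::real) (T::real) (\<alpha>::real) (\<kappa>::real)
      (f::real \<Rightarrow> real) (\<phi>::real \<Rightarrow> real) (g1::real \<Rightarrow> real) (g2::real \<Rightarrow> real)
      (w::real \<Rightarrow> real \<Rightarrow> real).
      a < b \<and> 0 < T \<and> 0 < \<alpha> \<and> \<alpha> < 1 \<and> 0 < \<kappa> \<and>
      (\<exists>M. M-lipschitz_on {a..b} f) \<and>
      ibvp_solution a b T \<alpha> \<kappa> f \<phi> g1 g2 w \<and>
      C_on m ({a..b} \<times> {0..T}) (\<lambda>(x, t). w x t) \<longrightarrow>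
      (\<exists>C>0. \<forall>(N::nat) (L::nat) (W::nat \<Rightarrow> nat \<Rightarrow> real).
         1 \<le> N \<and> 1 \<le> L \<and> fv_solution a b T \<alpha> \<kappa> f g1 g2 N L W \<longrightarrow>
         (let h = space_step a b N; \<tau> = time_step T L; e = grid_error a h \<tau> w W in
          \<forall>n\<in>{1..L}.
            discrete_L1_norm h N (e n)
              \<le> discrete_L1_norm h N (e 0) + C * (\<tau> powr (2 - \<alpha>) + h) \<and>
            (h * (SUP x\<in>{a..b}. \<bar>f x\<bar>) \<le> 2 * \<kappa> \<longrightarrow>
             discrete_L1_norm h N (e n)
               \<le> discrete_L1_norm h N (e 0) + C * (\<tau> powr (2 - \<alpha>) + h^2))))"
proof (intro exI[of _ "Suc (Suc (Suc (Suc 0)))"] allI impI)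
  fix a b T \<alpha> \<kappa> :: real and f \<phi> g1 g2 :: "real \<Rightarrow> real" and w :: "real \<Rightarrow> real \<Rightarrow> real"
  assume *: "a < b \<and> 0 < T \<and> 0 < \<alpha> \<and> \<alpha> < 1 \<and> 0 < \<kappa> \<and>
      (\<exists>M. M-lipschitz_on {a..b} f) \<and>
      ibvp_solution a b T \<alpha> \<kappa> f \<phi> g1 g2 w \<and>
      C_on (Suc (Suc (Suc (Suc 0)))) ({a..b} \<times> {0..T}) (\<lambda>(x, t). w x t)"
  then obtain P where "0 \<le> P" and P:
    "\<And>N L W n. fv_solution a b T \<alpha> \<kappa> f g1 g2 N L W \<Longrightarrow> n \<in> {1..L} \<Longrightarrow>
      discrete_L1_norm (space_step a b N) N (grid_error a (space_step a b N) (time_step T L) w W n)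
      \<le> discrete_L1_norm (space_step a b N) N (grid_error a (space_step a b N) (time_step T L) w W 0)
        + P * (time_step T L powr (2 - \<alpha>) + (space_step a b N)^2)"
    using fv_convergence[of a b T \<alpha> \<kappa>] by metis
  \<comment> \<open>The factor \<open>1 + (b - a)\<close> absorbs
    \<open>h^2 \<le> (b - a) * h\<close>, which gives the first-order estimate (i). The summand 1
    makes \<open>C\<close> positive even if \<open>P = 0\<close>.\<close>
  define C where "C = P * (1 + (b - a)) + 1"
  have "P * 1 \<le> P * (1 + (b - a))"
    using \<open>0 \<le> P\<close> * by (intro mult_left_mono) auto
  then have C: "0 < C" "P \<le> C" "P * (1 + (b - a)) \<le> C"
    using \<open>0 \<le> P\<close> by (auto simp: C_def)
  have le: "P * (s + h^2) \<le> C * (s + h)" "P * (s + h^2) \<le> C * (s + h^2)"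
    if "0 < h" "h \<le> b - a" "0 \<le> s" for s h :: real
  proof -
    have "s + h^2 \<le> (1 + (b - a)) * (s + h)"
    proof -
      have "h * h \<le> (b - a) * h" "0 \<le> (b - a) * s"
        using that by (auto intro: mult_right_mono)
      then show ?thesis using that by (simp add: power2_eq_square algebra_simps)
    qed
    then have "P * (s + h^2) \<le> P * ((1 + (b - a)) * (s + h))"
      using \<open>0 \<le> P\<close> by (rule mult_left_mono)
    also have "\<dots> \<le> C * (s + h)"
      using mult_right_mono[OF C(3), of "s + h"] that by (simp add: mult.assoc)
    finally show "P * (s + h^2) \<le> C * (s + h)" .
    show "P * (s + h^2) \<le> C * (s + h^2)"
      using that by (intro mult_right_mono C) auto
  qed
  show "\<exists>C>0. \<forall>(N::nat) (L::nat) (W::nat \<Rightarrow> nat \<Rightarrow> real).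
         1 \<le> N \<and> 1 \<le> L \<and> fv_solution a b T \<alpha> \<kappa> f g1 g2 N L W \<longrightarrow>
         (let h = space_step a b N; \<tau> = time_step T L; e = grid_error a h \<tau> w W in
          \<forall>n\<in>{1..L}.
            discrete_L1_norm h N (e n)
              \<le> discrete_L1_norm h N (e 0) + C * (\<tau> powr (2 - \<alpha>) + h) \<and>
            (h * (SUP x\<in>{a..b}. \<bar>f x\<bar>) \<le> 2 * \<kappa> \<longrightarrow>
             discrete_L1_norm h N (e n)
               \<le> discrete_L1_norm h N (e 0) + C * (\<tau> powr (2 - \<alpha>) + h^2)))"
    unfolding Let_def
  proof (intro exI[of _ C] conjI allI impI ballI)
    fix N L n :: nat and W :: "nat \<Rightarrow> nat \<Rightarrow> real"
    assume W: "1 \<le> N \<and> 1 \<le> L \<and> fv_solution a b T \<alpha> \<kappa> f g1 g2 N L W" and n: "n \<in> {1..L}"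
    have h: "0 < space_step a b N" "space_step a b N \<le> b - a"
      using * by (simp_all add: grid_points)
    note bound = order_trans[OF P add_left_mono]
    show "discrete_L1_norm (space_step a b N) N (grid_error a (space_step a b N) (time_step T L) w W n)
      \<le> discrete_L1_norm (space_step a b N) N (grid_error a (space_step a b N) (time_step T L) w W 0)
        + C * (time_step T L powr (2 - \<alpha>) + space_step a b N)"
      using W n by (intro bound le h) auto
    show "discrete_L1_norm (space_step a b N) N (grid_error a (space_step a b N) (time_step T L) w W n)
      \<le> discrete_L1_norm (space_step a b N) N (grid_error a (space_step a b N) (time_step T L) w W 0)
        + C * (time_step T L powr (2 - \<alpha>) + (space_step a b N)^2)"
      using W n by (intro bound le h) auto
  qed (rule C)
qed

end
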